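(* Let $H$ be a Hilbert space and let $P\subseteq H$ be a $\sigma$-porous set. Then $P$ is $\Gamma_1$-null in $H$; that is, the set of all $\gamma\in\Gamma_1(H)$ such that $\{t\in[0,1]:\gamma(t)\in P\}$ has Lebesgue measure zero is a residual subset of $\Gamma_1(H)$.
   Context: For a metric space $(M,d)$ and $c\in(0,1)$, a set $E\subseteq M$ is $c$-porous at $x\in E$ if for every $\epsilon>0$ there exist $h\in M$ and a real number $r>0$ with $d(x,h)<\epsilon$, $B(h,r)\cap E=\emptyset$ and $r>c\,d(x,h)$, where $B(h,r)$ is the open ball with centre $h$ and radius $r$. $E$ is $c$-porous if it is $c$-porous at every $x\in E$; $E$ is porous if it is $c$-porous for some $c\in(0,1)$. A set is $\sigma$-porous if it is a countable union of porous subsets of $M$. $\Gamma_1(H)=C^1([0,1],H)$ is the Banach space of continuously differentiable maps $[0,1]\to H$ with norm $\|\gamma\|+\|\gamma'\|$, where each term is a supremum norm over $[0,1]$. A subset of $\Gamma_1(H)$ is residual if its complement is of first category (meagre). A set $A\subseteq H$ is $\Gamma_1$-null if $\{t\in[0,1]:\gamma(t)\in A\}$ has Lebesgue measure zero for residually many $\gamma\in\Gamma_1(H)$. For arbitrary subsets of $[0,1]$, measure zero means Lebesgue outer measure zero. *)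

theory Defs
  imports "HOL-Analysis.Analysis"
begin

section \<open>Porosity\<close>

definition porous_at :: "real \<Rightarrow> 'a::metric_space set \<Rightarrow> 'a \<Rightarrow> bool" where
  "porous_at c E x \<longleftrightarrow>
     (\<forall>\<epsilon>>0. \<exists>h r. r > 0 \<and> dist x h < \<epsilon> \<and> ball h r \<inter> E = {} \<and> r > c * dist x h)"

definition c_porous :: "real \<Rightarrow> 'a::metric_space set \<Rightarrow> bool" where
  "c_porous c E \<longleftrightarrow> (\<forall>x\<in>E. porous_at c E x)"

definition porous :: "'a::metric_space set \<Rightarrow> bool" where
  "porous E \<longleftrightarrow> (\<exists>c. 0 < c \<and> c < 1 \<and> c_porous c E)"

definition sigma_porous :: "'a::metric_space set \<Rightarrow> bool" where
  "sigma_porous P \<longleftrightarrow> (\<exists>\<F>. countable \<F> \<and> (\<forall>E\<in>\<F>. porous E) \<and> P = \<Union>\<F>)"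


section \<open>Baire category\<close>

definition nowhere_dense :: "'a::topological_space set \<Rightarrow> bool" where
  "nowhere_dense N \<longleftrightarrow> interior (closure N) = {}"

definition meagre :: "'a::topological_space set \<Rightarrow> bool" where
  "meagre S \<longleftrightarrow> (\<exists>\<F>. countable \<F> \<and> (\<forall>N\<in>\<F>. nowhere_dense N) \<and> S = \<Union>\<F>)"

definition residual :: "'a::topological_space set \<Rightarrow> bool" where
  "residual S \<longleftrightarrow> meagre (- S)"


section \<open>The Banach space of continuously differentiable maps on the unit interval\<close>

text \<open>A map on \<open>[0,1]\<close> is represented by its extension by zero to the whole real line, which
  makes the representation unique. Derivatives are taken within \<open>[0,1]\<close>, so they are one-sided
  at the end points and the values outside \<open>[0,1]\<close> play no role.\<close>

definition c1_fun :: "(real \<Rightarrow> 'a::real_normed_vector) \<Rightarrow> bool" where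
  "c1_fun f \<longleftrightarrow> (\<exists>f'. continuous_on {0..1} f' \<and>
     (\<forall>t\<in>{0..1}. (f has_vector_derivative f' t) (at t within {0..1})))"

lemma c1_fun_0: "c1_fun (\<lambda>_. 0)"
  unfolding c1_fun_def by (intro exI[of _ "\<lambda>_. 0"]) (auto intro!: derivative_eq_intros)

lemma c1_fun_add:
  assumes "c1_fun f" "c1_fun g"
  shows "c1_fun (\<lambda>t. f t + g t)"
proof -
  obtain f' g' where "continuous_on {0..1} f'" "continuous_on {0..1} g'"
    "\<forall>t\<in>{0..1}. (f has_vector_derivative f' t) (at t within {0..1})"
    "\<forall>t\<in>{0..1}. (g has_vector_derivative g' t) (at t within {0..1})"
    using assms unfolding c1_fun_def by blast
  then show ?thesis
    unfolding c1_fun_def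
    by (intro exI[of _ "\<lambda>t. f' t + g' t"])
       (auto intro!: continuous_intros has_vector_derivative_add)
qed

lemma c1_fun_scaleR:
  assumes "c1_fun f"
  shows "c1_fun (\<lambda>t. a *\<^sub>R f t)"
proof -
  obtain f' where "continuous_on {0..1} f'"
    "\<forall>t\<in>{0..1}. (f has_vector_derivative f' t) (at t within {0..1})"
    using assms unfolding c1_fun_def by blast
  then show ?thesis
    unfolding c1_fun_def
    by (intro exI[of _ "\<lambda>t. a *\<^sub>R f' t"])
       (auto intro!: continuous_intros
          bounded_linear.has_vector_derivative[OF bounded_linear_scaleR_right])
qed

typedef (overloaded) 'a c1 =
    "{f :: real \<Rightarrow> 'a::real_normed_vector. c1_fun f \<and> (\<forall>t. t \<notin> {0..1} \<longrightarrow> f t = 0)}"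
  morphisms c1_apply Abs_c1
  using c1_fun_0 by auto

setup_lifting type_definition_c1

definition c1_deriv :: "'a::real_normed_vector c1 \<Rightarrow> real \<Rightarrow> 'a" where
  "c1_deriv \<gamma> t = vector_derivative (c1_apply \<gamma>) (at t within {0..1})"

lemma c1_apply_outside: "t \<notin> {0..1} \<Longrightarrow> c1_apply \<gamma> t = 0"
  using c1_apply[of \<gamma>] by auto

lemma c1_eqI: "(\<And>t. t \<in> {0..1} \<Longrightarrow> c1_apply f t = c1_apply g t) \<Longrightarrow> f = g"
  by (metis c1_apply_outside c1_apply_inject ext)

lemma c1_apply_Abs:
  assumes "c1_fun f" "t \<in> {0..1}"
  shows "c1_apply (Abs_c1 (\<lambda>t. if t \<in> {0..1} then f t else 0)) t = f t"
proof -
  have "c1_fun (\<lambda>t. if t \<in> {0..1} then f t else 0)"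
    using assms(1) unfolding c1_fun_def
    by (elim exE, intro exI conjI) (auto intro: has_vector_derivative_transform)
  then show ?thesis
    using assms(2) by (subst Abs_c1_inverse) auto
qed

lemma c1_deriv_unique:
  assumes "t \<in> {0..1}" "(c1_apply \<gamma> has_vector_derivative d) (at t within {0..1})"
  shows "c1_deriv \<gamma> t = d"
  using assms unfolding c1_deriv_def
  by (metis box_real(2) vector_derivative_within_cbox zero_less_one)

lemma c1_has_deriv:
  assumes "t \<in> {0..1}"
  shows "(c1_apply \<gamma> has_vector_derivative c1_deriv \<gamma> t) (at t within {0..1})"
proof -
  obtain f' where "\<forall>t\<in>{0..1}. (c1_apply \<gamma> has_vector_derivative f' t) (at t within {0..1})"
    using c1_apply[of \<gamma>] unfolding c1_fun_def by blast
  then show ?thesis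
    using assms c1_deriv_unique by metis
qed

lemma continuous_on_c1_deriv: "continuous_on {0..1} (c1_deriv \<gamma>)"
proof -
  obtain f' where "continuous_on {0..1} f'"
    "\<forall>t\<in>{0..1}. (c1_apply \<gamma> has_vector_derivative f' t) (at t within {0..1})"
    using c1_apply[of \<gamma>] unfolding c1_fun_def by blast
  then show ?thesis
    using c1_deriv_unique by (metis continuous_on_cong)
qed

lemma continuous_on_c1_apply: "continuous_on {0..1} (c1_apply \<gamma>)"
  by (rule continuous_on_vector_derivative) (rule c1_has_deriv)

definition sup_norm :: "(real \<Rightarrow> 'a::real_normed_vector) \<Rightarrow> real" where
  "sup_norm f = (SUP t\<in>{0..1}. norm (f t))"

lemma sup_norm_least:
  assumes "\<And>t. t \<in> {0..1} \<Longrightarrow> norm (f t) \<le> B"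
  shows "sup_norm f \<le> B"
  unfolding sup_norm_def by (rule cSUP_least) (use assms in auto)

lemma sup_norm_upper:
  assumes "continuous_on {0..1} f" "t \<in> {0..1}"
  shows "norm (f t) \<le> sup_norm f"
proof -
  have "bounded (f ` {0..1})"
    using assms(1) by (intro compact_imp_bounded compact_continuous_image) auto
  then have "bdd_above ((\<lambda>t. norm (f t)) ` {0..1})"
    unfolding bounded_iff bdd_above_def by auto
  then show ?thesis
    unfolding sup_norm_def using assms(2) by (rule cSUP_upper[rotated])
qed

lemma sup_norm_nonneg: "continuous_on {0..1} f \<Longrightarrow> 0 \<le> sup_norm f"
  by (rule order_trans[OF norm_ge_zero sup_norm_upper[of _ 0]]) auto

lemma sup_norm_add:
  assumes "continuous_on {0..1} f" "continuous_on {0..1} g"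
  shows "sup_norm (\<lambda>t. f t + g t) \<le> sup_norm f + sup_norm g"
  by (intro sup_norm_least order_trans[OF norm_triangle_ineq] add_mono sup_norm_upper assms)

lemma sup_norm_scaleR:
  assumes "continuous_on {0..1} f"
  shows "sup_norm (\<lambda>t. a *\<^sub>R f t) = \<bar>a\<bar> * sup_norm f"
proof (cases "a = 0")
  case True
  then show ?thesis
    by (simp add: sup_norm_def)
next
  case False
  show ?thesis
  proof (rule antisym)
    show "sup_norm (\<lambda>t. a *\<^sub>R f t) \<le> \<bar>a\<bar> * sup_norm f"
      by (intro sup_norm_least) (auto intro!: mult_left_mono sup_norm_upper assms)
    have "sup_norm f \<le> sup_norm (\<lambda>t. a *\<^sub>R f t) / \<bar>a\<bar>"
    proof (intro sup_norm_least)
      fix t :: real assume t: "t \<in> {0..1}"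
      have "norm (a *\<^sub>R f t) \<le> sup_norm (\<lambda>t. a *\<^sub>R f t)"
        using t by (intro sup_norm_upper[of "\<lambda>t. a *\<^sub>R f t"]) (auto intro!: continuous_intros assms)
      then show "norm (f t) \<le> sup_norm (\<lambda>t. a *\<^sub>R f t) / \<bar>a\<bar>"
        using False by (simp add: field_simps)
    qed
    then show "\<bar>a\<bar> * sup_norm f \<le> sup_norm (\<lambda>t. a *\<^sub>R f t)"
      using False by (simp add: field_simps)
  qed
qed

instantiation c1 :: (real_normed_vector) real_vector
begin

lift_definition zero_c1 :: "'a c1" is "\<lambda>_. 0"
  using c1_fun_0 by auto

lift_definition plus_c1 :: "'a c1 \<Rightarrow> 'a c1 \<Rightarrow> 'a c1" is "\<lambda>f g t. f t + g t"
  using c1_fun_add by auto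

lift_definition scaleR_c1 :: "real \<Rightarrow> 'a c1 \<Rightarrow> 'a c1" is "\<lambda>a f t. a *\<^sub>R f t"
  using c1_fun_scaleR by auto

lift_definition uminus_c1 :: "'a c1 \<Rightarrow> 'a c1" is "\<lambda>f t. - f t"
  using c1_fun_scaleR[of _ "-1"] by auto

lift_definition minus_c1 :: "'a c1 \<Rightarrow> 'a c1 \<Rightarrow> 'a c1" is "\<lambda>f g t. f t - g t"
  using c1_fun_add c1_fun_scaleR[of _ "-1"] by fastforce

instance
proof
  fix f g h :: "'a c1" and a b :: real
  show "f + g + h = f + (g + h)" "f + g = g + f" "0 + f = f"
    by (transfer; simp add: add_ac)+
  show "- f + f = 0" "f - g = f + - g"
    by (transfer; simp)+
  show "a *\<^sub>R (f + g) = a *\<^sub>R f + a *\<^sub>R g" "(a + b) *\<^sub>R f = a *\<^sub>R f + b *\<^sub>R f"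
    "a *\<^sub>R b *\<^sub>R f = (a * b) *\<^sub>R f" "1 *\<^sub>R f = f"
    by (transfer; simp add: algebra_simps)+
qed

end

instantiation c1 :: (real_normed_vector) real_normed_vector
begin

definition norm_c1 :: "'a c1 \<Rightarrow> real" where
  "norm_c1 \<gamma> = sup_norm (c1_apply \<gamma>) + sup_norm (c1_deriv \<gamma>)"

definition dist_c1 :: "'a c1 \<Rightarrow> 'a c1 \<Rightarrow> real" where
  "dist_c1 f g = norm (f - g)"

definition sgn_c1 :: "'a c1 \<Rightarrow> 'a c1" where
  "sgn_c1 f = f /\<^sub>R norm f"

definition uniformity_c1 :: "('a c1 \<times> 'a c1) filter" where
  "uniformity_c1 = (INF e\<in>{0 <..}. principal {(x, y). dist x y < e})"

definition open_c1 :: "'a c1 set \<Rightarrow> bool" where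
  "open_c1 U \<longleftrightarrow> (\<forall>x\<in>U. \<forall>\<^sub>F (x', y) in uniformity. x' = x \<longrightarrow> y \<in> U)"

lemma c1_deriv_plus: "t \<in> {0..1} \<Longrightarrow> c1_deriv (f + g) t = c1_deriv f t + c1_deriv g t"
  by (intro c1_deriv_unique)
     (simp_all add: plus_c1.rep_eq has_vector_derivative_add c1_has_deriv)

lemma c1_deriv_scaleR: "t \<in> {0..1} \<Longrightarrow> c1_deriv (a *\<^sub>R f) t = a *\<^sub>R c1_deriv f t"
  by (intro c1_deriv_unique)
     (simp_all add: scaleR_c1.rep_eq c1_has_deriv
        bounded_linear.has_vector_derivative[OF bounded_linear_scaleR_right])

lemma sup_norm_cong: "(\<And>t. t \<in> {0..1} \<Longrightarrow> f t = g t) \<Longrightarrow> sup_norm f = sup_norm g"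
  unfolding sup_norm_def by (intro SUP_cong) auto

instance
proof
  fix f g :: "'a c1" and a :: real
  show "dist f g = norm (f - g)"
    by (rule dist_c1_def)
  show "sgn f = f /\<^sub>R norm f"
    by (rule sgn_c1_def)
  show "(uniformity :: ('a c1 \<times> 'a c1) filter) = (INF e\<in>{0 <..}. principal {(x, y). dist x y < e})"
    by (rule uniformity_c1_def)
  show "open U \<longleftrightarrow> (\<forall>x\<in>U. \<forall>\<^sub>F (x', y) in uniformity. x' = x \<longrightarrow> y \<in> U)" for U :: "'a c1 set"
    by (rule open_c1_def)
  note cont = continuous_on_c1_apply continuous_on_c1_deriv
  show "norm f = 0 \<longleftrightarrow> f = 0"
  proof
    assume "norm f = 0"
    then have "sup_norm (c1_apply f) = 0"
      using sup_norm_nonneg[OF cont(1)[of f]] sup_norm_nonneg[OF cont(2)[of f]]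
      by (simp add: norm_c1_def)
    then show "f = 0"
      using sup_norm_upper[OF cont(1)[of f]] by (intro c1_eqI) (simp add: zero_c1.rep_eq)
  next
    assume [simp]: "f = 0"
    have "sup_norm (c1_deriv f) = sup_norm (\<lambda>_. 0 :: 'a)"
      by (intro sup_norm_cong c1_deriv_unique) (auto simp: zero_c1.rep_eq)
    then show "norm f = 0"
      by (simp add: norm_c1_def zero_c1.rep_eq sup_norm_def)
  qed
  show "norm (f + g) \<le> norm f + norm g"
    using sup_norm_add[OF cont(1)[of f] cont(1)[of g]] sup_norm_add[OF cont(2)[of f] cont(2)[of g]]
      sup_norm_cong[OF c1_deriv_plus[of _ f g]]
    by (simp add: norm_c1_def plus_c1.rep_eq)
  show "norm (a *\<^sub>R f) = \<bar>a\<bar> * norm f"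
    using sup_norm_scaleR[OF cont(1)[of f], of a] sup_norm_scaleR[OF cont(2)[of f], of a]
      sup_norm_cong[OF c1_deriv_scaleR[of _ a f]]
    by (simp add: norm_c1_def scaleR_c1.rep_eq algebra_simps)
qed

end

lemma c1_apply_diff: "c1_apply (f - g) t = c1_apply f t - c1_apply g t"
  by (simp add: minus_c1.rep_eq)

lemma c1_deriv_diff: "t \<in> {0..1} \<Longrightarrow> c1_deriv (f - g) t = c1_deriv f t - c1_deriv g t"
  by (intro c1_deriv_unique)
     (simp_all add: minus_c1.rep_eq has_vector_derivative_diff c1_has_deriv)

lemma norm_c1_apply_le: "t \<in> {0..1} \<Longrightarrow> norm (c1_apply f t) \<le> norm f"
  using sup_norm_upper[OF continuous_on_c1_apply[of f], of t]
    sup_norm_nonneg[OF continuous_on_c1_deriv[of f]]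
  by (simp add: norm_c1_def)

lemma norm_c1_deriv_le: "t \<in> {0..1} \<Longrightarrow> norm (c1_deriv f t) \<le> norm f"
  using sup_norm_upper[OF continuous_on_c1_deriv[of f], of t]
    sup_norm_nonneg[OF continuous_on_c1_apply[of f]]
  by (simp add: norm_c1_def)

instance c1 :: (banach) banach
proof
  fix X :: "nat \<Rightarrow> 'a c1"
  assume X: "Cauchy X"
  define f where "f n = c1_apply (X n)" for n
  define f' where "f' n = c1_deriv (X n)" for n
  have "dist (f m t) (f n t) \<le> dist (X m) (X n)" "dist (f' m t) (f' n t) \<le> dist (X m) (X n)"
    if "t \<in> {0..1}" for m n t
    using norm_c1_apply_le[OF that, of "X m - X n"] norm_c1_deriv_le[OF that, of "X m - X n"] that
    by (simp_all add: dist_norm f_def f'_def c1_apply_diff c1_deriv_diff)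
  then have "uniformly_Cauchy_on {0..1} f" "uniformly_Cauchy_on {0..1} f'"
    using X unfolding uniformly_Cauchy_on_def Cauchy_def by (meson le_less_trans)+
  then obtain g g' where g: "uniform_limit {0..1} f g sequentially"
    and g': "uniform_limit {0..1} f' g' sequentially"
    using Cauchy_uniformly_convergent unfolding uniformly_convergent_on_def by metis
  have cont: "continuous_on {0..1} g'"
    by (rule uniform_limit_theorem[OF _ g']) (auto simp: f'_def continuous_on_c1_deriv)
  have "\<exists>k. \<forall>t\<in>{0..1}. (\<lambda>n. f n t) \<longlonglongrightarrow> k t \<and>
          (k has_derivative (\<lambda>x. x *\<^sub>R g' t)) (at t within {0..1})"
  proof (rule has_derivative_sequence[where f' = "\<lambda>n t x. x *\<^sub>R f' n t" and ?x0.0 = 0])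
    show "(f n has_derivative (\<lambda>x. x *\<^sub>R f' n t)) (at t within {0..1})" if "t \<in> {0..1}" for n t
      using c1_has_deriv[OF that] by (simp add: has_vector_derivative_def f_def f'_def)
    show "(\<lambda>n. f n 0) \<longlonglongrightarrow> g 0"
      by (rule tendsto_uniform_limitI[OF g]) auto
    fix e :: real assume "e > 0"
    with g' have "\<forall>\<^sub>F n in sequentially. \<forall>t\<in>{0..1}. dist (f' n t) (g' t) < e"
      by (auto simp: uniform_limit_iff)
    then show "\<forall>\<^sub>F n in sequentially. \<forall>t\<in>{0..1}. \<forall>h. norm (h *\<^sub>R f' n t - h *\<^sub>R g' t) \<le> e * norm h"
    proof eventually_elim
      case (elim n)
      show ?case
      proof (intro ballI allI)
        fix t h :: real assume "t \<in> {0..1}"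
        with elim have "norm (f' n t - g' t) \<le> e"
          by (force simp: dist_norm)
        then show "norm (h *\<^sub>R f' n t - h *\<^sub>R g' t) \<le> e * norm h"
          by (simp add: mult.commute[of e] mult_left_mono flip: scaleR_diff_right)
      qed
    qed
  qed auto
  then obtain k where k: "\<And>t. t \<in> {0..1} \<Longrightarrow> (\<lambda>n. f n t) \<longlonglongrightarrow> k t"
    "\<And>t. t \<in> {0..1} \<Longrightarrow> (k has_vector_derivative g' t) (at t within {0..1})"
    unfolding has_vector_derivative_def by blast
  have kg: "k t = g t" if "t \<in> {0..1}" for t
    using k(1)[OF that] tendsto_uniform_limitI[OF g that] by (rule LIMSEQ_unique)
  have gd: "(g has_vector_derivative g' t) (at t within {0..1})" if "t \<in> {0..1}" for t
    using that kg k(2)[OF that] by (metis has_vector_derivative_transform)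
  have c1: "c1_fun g"
    unfolding c1_fun_def using cont gd by blast
  define Y where "Y = Abs_c1 (\<lambda>t. if t \<in> {0..1} then g t else 0)"
  have Y: "c1_apply Y t = g t" if "t \<in> {0..1}" for t
    unfolding Y_def using c1_apply_Abs[OF c1 that] .
  have Y': "c1_deriv Y t = g' t" if "t \<in> {0..1}" for t
    using gd[OF that] that Y
    by (intro c1_deriv_unique) (auto intro: has_vector_derivative_transform)
  have "X \<longlonglongrightarrow> Y"
  proof (rule metric_LIMSEQ_I)
    fix e :: real assume "e > 0"
    then have "\<forall>\<^sub>F n in sequentially. \<forall>t\<in>{0..1}. dist (f n t) (g t) < e / 3"
      "\<forall>\<^sub>F n in sequentially. \<forall>t\<in>{0..1}. dist (f' n t) (g' t) < e / 3"
      using uniform_limitD[OF g, of "e / 3"] uniform_limitD[OF g', of "e / 3"] by simp_all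
    then have "\<forall>\<^sub>F n in sequentially. dist (X n) Y < e"
    proof eventually_elim
      case (elim n)
      have "sup_norm (c1_apply (X n - Y)) \<le> e / 3"
        using elim(1) Y by (intro sup_norm_least) (force simp: c1_apply_diff dist_norm f_def)
      moreover have "sup_norm (c1_deriv (X n - Y)) \<le> e / 3"
        using elim(2) Y' by (intro sup_norm_least) (force simp: c1_deriv_diff dist_norm f'_def)
      ultimately show ?case
        using \<open>e > 0\<close> by (simp add: dist_norm norm_c1_def)
    qed
    then show "\<exists>N. \<forall>n\<ge>N. dist (X n) Y < e"
      by (simp add: eventually_sequentially)
  qed
  then show "convergent X"
    by (auto simp: convergent_def)
qed


section \<open>Null sets with respect to curves\<close>

text \<open>The outer measure is used because the preimage of an arbitrary set under a curve need not be
  measurable.\<close>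

definition Gamma1_null :: "'a::real_normed_vector set \<Rightarrow> bool" where
  "Gamma1_null A \<longleftrightarrow>
     residual {\<gamma> :: 'a c1. outer_measure_of lebesgue {t \<in> {0..1}. c1_apply \<gamma> t \<in> A} = 0}"

lemma outer_measure_of_lebesgue_eq_0_iff: "outer_measure_of lebesgue S = 0 \<longleftrightarrow> negligible S"
proof
  assume "outer_measure_of lebesgue S = 0"
  moreover obtain E where "E \<in> sets lebesgue" "S \<subseteq> E"
    "outer_measure_of lebesgue S = emeasure lebesgue E"
    using outer_measure_of_attain[of S lebesgue] by auto
  ultimately have "E \<in> null_sets lebesgue"
    by (metis null_setsI)
  then show "negligible S"
    using \<open>S \<subseteq> E\<close> by (metis negligible_iff_null_sets negligible_subset)
next
  assume "negligible S"
  then show "outer_measure_of lebesgue S = 0"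
    by (auto simp: negligible_iff_null_sets null_sets_def)
qed

end

theory Submission
  imports Defs
begin

text \<open>
  A \<open>\<sigma>\<close>-porous set has countably many porous pieces, and a piece that is met for positive outer time is met
  for more than \<open>1/(n+1)\<close> for some \<open>n\<close>. So it suffices that, for one \<open>c\<close>-porous set \<open>E\<close> and
  one \<open>\<delta> > 0\<close>, the curves that spend outer time more than \<open>\<delta>\<close> in \<open>E\<close> form a nowhere dense set.
  Suppose they were dense near some curve \<open>\<gamma>0\<close>. Write \<open>F\<close> for the closure of \<open>E\<close> and minimise, over
  a small \<open>C\<^sup>1\<close> neighbourhood of \<open>\<gamma>0\<close>, the functional

    \<open>\<Phi> \<gamma> = |{t. \<gamma> t \<in> F}| + \<lambda> \<integral> |\<gamma>' - \<gamma>0'|\<^sup>2\<close>.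

  It is upper semicontinuous, because \<open>F\<close> is closed, so by density some almost-minimiser \<open>\<gamma>\<close> itself
  spends time more than \<open>\<delta>\<close> in \<open>E\<close>. The weight \<open>\<lambda>\<close> is so large that \<open>\<gamma>'\<close> stays far from the
  boundary of the neighbourhood except on a set of times of measure at most \<open>\<delta>/2\<close>.

  At each remaining time \<open>t\<close> with \<open>\<gamma> t \<in> E\<close> there are arbitrarily small holes of \<open>E\<close>. A bump of
  height \<open>\<rho>\<close>, where \<open>\<rho>\<close> is the distance to the centre of the hole, and slope of order \<open>\<epsilon>\<close> occupies
  an interval of length about \<open>\<rho>/\<epsilon>\<close> and puts the curve into the hole for a time comparable
  to \<open>\<rho>\<close>. By Vitali's covering theorem finitely many disjoint such bumps, of total length
  \<open>\<sigma> > \<delta>/2\<close>, can be added to \<open>\<gamma>\<close> simultaneously. The first term of \<open>\<Phi>\<close> drops by a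
  multiple of \<open>\<epsilon> \<sigma>\<close>. The second term grows only by a multiple of \<open>\<lambda> \<epsilon>\<^sup>2 \<sigma>\<close>: the derivative of
  each bump has mean zero and is therefore nearly orthogonal to the nearly constant
  \<open>\<gamma>' - \<gamma>0'\<close>. This is where the inner product enters. For \<open>\<epsilon>\<close> small compared with \<open>1/\<lambda>\<close> the gain wins
  by an amount independent of \<open>\<gamma>\<close>, which contradicts almost-minimality. The perturbation step is
  \<open>porous_improvement\<close>, and the minimisation is carried out in
  \<open>nowhere_dense_long_time_in_porous\<close>.
\<close>

section \<open>A continuously differentiable bump\<close>

text \<open>The square of the positive part of \<open>1 - x\<^sup>2\<close> is \<open>C\<^sup>1\<close> also at \<open>\<plusminus>1\<close>, and its derivative is again an
  elementary expression, so that all estimates are polynomial inequalities.\<close>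

definition bump :: "real \<Rightarrow> real" where
  "bump x = (max 0 (1 - x\<^sup>2))\<^sup>2"

definition bump_deriv :: "real \<Rightarrow> real" where
  "bump_deriv x = - 4 * x * max 0 (1 - x\<^sup>2)"

lemma square_pos_part_has_derivative:
  "((\<lambda>x::real. (max 0 x)\<^sup>2) has_real_derivative 2 * max 0 x) (at x)"
proof -
  consider "x < 0" | "x = 0" | "x > 0" by linarith
  then show ?thesis
  proof cases
    case 1
    have "((\<lambda>x::real. (max 0 x)\<^sup>2) has_real_derivative 0) (at x)"
    proof (rule has_field_derivative_transform_within_open)
      show "((\<lambda>x::real. 0) has_real_derivative 0) (at x)" by (rule DERIV_const)
      show "open {..<0::real}" by simp
      show "x \<in> {..<0::real}" using 1 by simp
    qed simp
    then show ?thesis using 1 by (simp add: max_def)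
  next
    case 2
    have "isCont (\<lambda>z::real. max 0 z) 0"
      by (intro continuous_max continuous_const continuous_ident)
    moreover have "(max 0 z)\<^sup>2 - (max 0 (0::real))\<^sup>2 = max 0 z * (z - 0)" for z :: real
      by (simp add: max_def power2_eq_square)
    ultimately have "((\<lambda>x::real. (max 0 x)\<^sup>2) has_real_derivative 0) (at 0)"
      unfolding CARAT_DERIV by (intro exI[of _ "\<lambda>z. max 0 z"]) simp
    then show ?thesis using 2 by simp
  next
    case 3
    have d: "((\<lambda>x::real. x\<^sup>2) has_real_derivative 2 * x) (at x)"
      using DERIV_pow[of 2 x] by simp
    have "((\<lambda>x::real. (max 0 x)\<^sup>2) has_real_derivative 2 * x) (at x)"
    proof (rule has_field_derivative_transform_within_open[OF d])
      show "open {0::real<..}" by simp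
      show "x \<in> {0::real<..}" using 3 by simp
    qed simp
    then show ?thesis using 3 by (simp add: max_def)
  qed
qed

lemma bump_has_derivative: "(bump has_real_derivative bump_deriv x) (at x)"
proof -
  have "((\<lambda>x. 1 - x\<^sup>2) has_real_derivative - 2 * x) (at x)"
    by (auto intro!: derivative_eq_intros)
  from DERIV_chain2[OF square_pos_part_has_derivative this]
  show ?thesis
    by (simp add: bump_def[abs_def] bump_deriv_def algebra_simps)
qed

lemma continuous_bump_deriv [continuous_intros]:
  "continuous_on S f \<Longrightarrow> continuous_on S (\<lambda>x. bump_deriv (f x))"
  unfolding bump_deriv_def by (intro continuous_intros)

lemma bump_outside: "1 \<le> \<bar>x\<bar> \<Longrightarrow> bump x = 0" "1 \<le> \<bar>x\<bar> \<Longrightarrow> bump_deriv x = 0"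
proof -
  assume "1 \<le> \<bar>x\<bar>"
  then have "1 \<le> x\<^sup>2" by (metis abs_le_square_iff abs_one one_power2)
  then show "bump x = 0" "bump_deriv x = 0" by (auto simp: bump_def bump_deriv_def)
qed

lemma bump_le_1: "0 \<le> bump x" "bump x \<le> 1"
  by (auto simp: bump_def max_def intro!: power_le_one)

text \<open>Near its centre a bump still has almost full height; this keeps the perturbed curve inside the hole on
  an interval whose length is comparable to the radius of the hole.\<close>

lemma bump_near_1: "1 - bump x \<le> 2 * \<bar>x\<bar>"
proof (cases "\<bar>x\<bar> \<le> 1")
  case True
  then have "x\<^sup>2 \<le> 1" by (metis abs_square_le_1)
  have "x\<^sup>2 \<le> \<bar>x\<bar>"
    using True mult_left_mono[of "\<bar>x\<bar>" 1 "\<bar>x\<bar>"] by (simp add: power2_eq_square abs_mult_self_eq flip: abs_mult)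
  have "bump x = 1 - 2 * x\<^sup>2 + (x\<^sup>2)\<^sup>2"
    using \<open>x\<^sup>2 \<le> 1\<close> by (simp add: bump_def max_def power2_eq_square algebra_simps)
  then show ?thesis
    using \<open>x\<^sup>2 \<le> \<bar>x\<bar>\<close> zero_le_power2[of "x\<^sup>2"] by linarith
next
  case False
  then show ?thesis using bump_le_1(1)[of x] by linarith
qed

lemma bump_deriv_le_2: "\<bar>bump_deriv x\<bar> \<le> 2"
proof (cases "\<bar>x\<bar> \<le> 1")
  case True
  then have 1: "x\<^sup>2 \<le> 1" by (metis abs_square_le_1)
  have "2 * \<bar>x\<bar> \<le> 1 + x\<^sup>2"
    using zero_le_power2[of "\<bar>x\<bar> - 1"] by (simp add: power2_eq_square algebra_simps)
  then have "2 * \<bar>x\<bar> * (1 - x\<^sup>2) \<le> (1 + x\<^sup>2) * (1 - x\<^sup>2)"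
    using 1 by (intro mult_right_mono) auto
  also have "\<dots> = 1 - (x\<^sup>2)\<^sup>2" by (simp add: power2_eq_square algebra_simps)
  also have "\<dots> \<le> 1" by simp
  finally show ?thesis using 1 by (simp add: bump_deriv_def abs_mult max_def)
next
  case False
  then show ?thesis using bump_outside(2)[of x] by simp
qed

section \<open>Outer measure and disjoint intervals\<close>

lemma ennreal_pos_gt_inverse_Suc:
  assumes "(x::ennreal) \<noteq> 0"
  obtains n where "ennreal (inverse (real (Suc n))) < x"
proof (cases x rule: ennreal_cases)
  case (real r)
  then have "0 < r" using assms by (cases "r = 0") auto
  then obtain n where "inverse (real (Suc n)) < r" using reals_Archimedean by blast
  then show thesis using that[of n] real \<open>0 < r\<close> by (simp add: ennreal_less_iff)
next
  case top
  then show thesis using that[of 0] by simp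
qed

lemma outer_measure_of_lebesgue_Un:
  "outer_measure_of lebesgue (A \<union> B) \<le> outer_measure_of lebesgue A + outer_measure_of lebesgue B"
proof -
  obtain A' where A: "A' \<in> sets lebesgue" "A \<subseteq> A'" "outer_measure_of lebesgue A = emeasure lebesgue A'"
    using outer_measure_of_attain[of A lebesgue] by auto
  obtain B' where B: "B' \<in> sets lebesgue" "B \<subseteq> B'" "outer_measure_of lebesgue B = emeasure lebesgue B'"
    using outer_measure_of_attain[of B lebesgue] by auto
  have "outer_measure_of lebesgue (A \<union> B) \<le> outer_measure_of lebesgue (A' \<union> B')"
    using A B by (intro outer_measure_of_mono) auto
  also have "\<dots> = emeasure lebesgue (A' \<union> B')"
    using A B by (intro outer_measure_of_eq) auto
  also have "\<dots> \<le> emeasure lebesgue A' + emeasure lebesgue B'"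
    by (rule emeasure_subadditive[OF A(1) B(1)])
  finally show ?thesis using A(3) B(3) by simp
qed

lemma measure_lebesgue_cball_real: "0 \<le> r \<Longrightarrow> measure lebesgue (cball x r) = 2 * r" for x r :: real
  by (simp add: cball_eq_atLeastAtMost)

text \<open>Vitali's theorem covers almost all of \<open>S\<close> by countably many disjoint intervals, so their total length
  is at least the outer measure of \<open>S\<close>; continuity from below then yields finitely many of them that
  exceed any smaller bound. The set \<open>S\<close> may be non-measurable.\<close>

lemma finite_Vitali_intervals:
  fixes a r :: "'i \<Rightarrow> real"
  assumes r: "\<And>i. i \<in> K \<Longrightarrow> 0 < r i"
    and fine: "\<And>x d. \<lbrakk>x \<in> S; 0 < d\<rbrakk> \<Longrightarrow> \<exists>i. i \<in> K \<and> x \<in> cball (a i) (r i) \<and> r i < d"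
    and S: "ennreal \<alpha> < outer_measure_of lebesgue S" and "0 \<le> \<alpha>"
  obtains C where "finite C" "C \<subseteq> K"
    "pairwise (\<lambda>i j. disjnt (cball (a i) (r i)) (cball (a j) (r j))) C"
    "\<alpha> < (\<Sum>i\<in>C. 2 * r i)"
proof -
  obtain C where C: "countable C" "C \<subseteq> K"
    "pairwise (\<lambda>i j. disjnt (cball (a i) (r i)) (cball (a j) (r j))) C"
    "negligible (S - (\<Union>i\<in>C. cball (a i) (r i)))"
    by (rule Vitali_covering_theorem_cballs[of K r S a]) (use r fine in blast)+
  let ?U = "\<Union>i\<in>C. cball (a i) (r i)"
  \<comment> \<open>The finite subfamilies must increase to \<open>C\<close>, also when \<open>C\<close> is finite.\<close>
  define D where "D n = {i \<in> C. to_nat_on C i \<le> n}" for n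
  define A where "A n = (\<Union>i\<in>D n. cball (a i) (r i))" for n
  have finD: "finite (D n)" for n
  proof (rule inj_on_finite)
    show "inj_on (to_nat_on C) (D n)"
      using inj_on_to_nat_on[OF C(1)] by (rule inj_on_subset) (auto simp: D_def)
    show "to_nat_on C ` D n \<subseteq> {..n}" by (auto simp: D_def)
  qed simp
  have meas_ball: "cball (a i) (r i) \<in> lmeasurable" for i
    by (intro lmeasurable_compact compact_cball)
  have "ennreal \<alpha> < outer_measure_of lebesgue S" by (rule S)
  also have "\<dots> \<le> outer_measure_of lebesgue ((S - ?U) \<union> ?U)"
    by (intro outer_measure_of_mono) auto
  also have "\<dots> \<le> outer_measure_of lebesgue (S - ?U) + outer_measure_of lebesgue ?U"
    by (rule outer_measure_of_lebesgue_Un)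
  also have "\<dots> = outer_measure_of lebesgue ?U"
    using C(4) by (simp add: outer_measure_of_lebesgue_eq_0_iff)
  also have "\<dots> = emeasure lebesgue ?U"
    using C(1) meas_ball by (intro outer_measure_of_eq sets.countable_UN') (auto intro: fmeasurableD)
  also have "?U = (\<Union>n. A n)" by (auto simp: A_def D_def)
  also have "emeasure lebesgue (\<Union>n. A n) = (SUP n. emeasure lebesgue (A n))"
  proof (rule SUP_emeasure_incseq[symmetric])
    show "range A \<subseteq> sets lebesgue"
      using finD meas_ball by (auto simp: A_def intro!: sets.finite_UN fmeasurableD)
    show "incseq A" by (force simp: A_def D_def incseq_def)
  qed
  finally obtain n where n: "ennreal \<alpha> < emeasure lebesgue (A n)" by (auto simp: less_SUP_iff)
  have pw: "pairwise (\<lambda>i j. disjnt (cball (a i) (r i)) (cball (a j) (r j))) (D n)"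
    using C(3) by (rule pairwise_subset) (auto simp: D_def)
  have "A n \<in> lmeasurable"
    unfolding A_def using finD meas_ball by (intro fmeasurable.finite_UN) auto
  then have "\<alpha> < measure lebesgue (A n)"
    using n \<open>0 \<le> \<alpha>\<close> by (simp add: emeasure_eq_measure2 ennreal_less_iff)
  also have "\<dots> = (\<Sum>i\<in>D n. measure lebesgue (cball (a i) (r i)))"
    unfolding A_def by (rule measure_UNION'[OF finD meas_ball pw])
  also have "\<dots> = (\<Sum>i\<in>D n. 2 * r i)"
  proof (rule sum.cong[OF refl])
    fix i assume "i \<in> D n"
    then have "0 \<le> r i" using r[of i] C(2) by (auto simp: D_def)
    then show "measure lebesgue (cball (a i) (r i)) = 2 * r i"
      by (rule measure_lebesgue_cball_real)
  qed
  finally have "\<alpha> < (\<Sum>i\<in>D n. 2 * r i)" .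
  moreover have "D n \<subseteq> K" using C(2) by (auto simp: D_def)
  ultimately show thesis using that finD pw by blast
qed

section \<open>Curves built from disjoint bumps\<close>

text \<open>The bump with index \<open>i\<close> has its support in the interval of radius \<open>r i\<close> around \<open>a i\<close> and displaces
  the centre by exactly \<open>u i\<close>.\<close>

definition bumps :: "'i set \<Rightarrow> ('i \<Rightarrow> real) \<Rightarrow> ('i \<Rightarrow> real) \<Rightarrow> ('i \<Rightarrow> 'a::real_normed_vector) \<Rightarrow> 'a c1" where
  "bumps C a r u =
     Abs_c1 (\<lambda>s. if s \<in> {0..1} then \<Sum>i\<in>C. bump ((s - a i) / r i) *\<^sub>R u i else 0)"

lemma sum_bump_has_derivative:
  fixes u :: "'i \<Rightarrow> 'a::real_normed_vector"
  shows "((\<lambda>s. \<Sum>i\<in>C. bump ((s - a i) / r i) *\<^sub>R u i) has_vector_derivative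
     (\<Sum>i\<in>C. (bump_deriv ((s - a i) / r i) / r i) *\<^sub>R u i)) (at s within S)"
proof (rule has_vector_derivative_sum)
  fix i
  have "((\<lambda>s. (s - a i) / r i) has_real_derivative 1 / r i) (at s within S)"
    by (rule DERIV_cdivide) (auto intro!: derivative_eq_intros)
  from DERIV_chain2[OF bump_has_derivative this]
  have "((\<lambda>s. bump ((s - a i) / r i)) has_real_derivative bump_deriv ((s - a i) / r i) / r i) (at s within S)"
    by simp
  then have "((\<lambda>s. bump ((s - a i) / r i)) has_vector_derivative bump_deriv ((s - a i) / r i) / r i) (at s within S)"
    by (simp add: has_real_derivative_iff_has_vector_derivative)
  then show "((\<lambda>s. bump ((s - a i) / r i) *\<^sub>R u i) has_vector_derivative
     (bump_deriv ((s - a i) / r i) / r i) *\<^sub>R u i) (at s within S)"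
    by (rule bounded_linear.has_vector_derivative[OF bounded_linear_scaleR_left])
qed

lemma continuous_on_sum_bump_deriv:
  fixes u :: "'i \<Rightarrow> 'a::real_normed_vector"
  shows "continuous_on S (\<lambda>s. \<Sum>i\<in>C. (bump_deriv ((s - a i) / r i) / r i) *\<^sub>R u i)"
  unfolding divide_inverse
  by (intro continuous_on_sum continuous_on_scaleR continuous_on_mult continuous_bump_deriv
      continuous_on_diff continuous_on_id continuous_on_const)

lemma c1_apply_bumps:
  "s \<in> {0..1} \<Longrightarrow> c1_apply (bumps C a r u) s = (\<Sum>i\<in>C. bump ((s - a i) / r i) *\<^sub>R u i)"
  unfolding bumps_def
proof (rule c1_apply_Abs)
  show "c1_fun (\<lambda>s. \<Sum>i\<in>C. bump ((s - a i) / r i) *\<^sub>R u i)"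
    unfolding c1_fun_def using sum_bump_has_derivative continuous_on_sum_bump_deriv by blast
qed

lemma c1_deriv_bumps:
  assumes "s \<in> {0..1}"
  shows "c1_deriv (bumps C a r u) s = (\<Sum>i\<in>C. (bump_deriv ((s - a i) / r i) / r i) *\<^sub>R u i)"
  by (rule c1_deriv_unique[OF assms])
     (rule has_vector_derivative_transform[OF assms _ sum_bump_has_derivative], rule c1_apply_bumps)

lemma sum_bumps_outside:
  fixes u :: "'i \<Rightarrow> 'a::real_normed_vector"
  assumes "\<And>i. i \<in> C \<Longrightarrow> 0 < r i" "\<And>i. i \<in> C \<Longrightarrow> r i \<le> \<bar>s - a i\<bar>"
  shows "(\<Sum>i\<in>C. bump ((s - a i) / r i) *\<^sub>R u i) = 0"
    "(\<Sum>i\<in>C. (bump_deriv ((s - a i) / r i) / r i) *\<^sub>R u i) = 0"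
proof -
  have "1 \<le> \<bar>(s - a i) / r i\<bar>" if "i \<in> C" for i
    using assms[OF that] by (simp add: abs_of_pos)
  then show "(\<Sum>i\<in>C. bump ((s - a i) / r i) *\<^sub>R u i) = 0"
    "(\<Sum>i\<in>C. (bump_deriv ((s - a i) / r i) / r i) *\<^sub>R u i) = 0"
    by (simp_all add: bump_outside)
qed

lemma sum_bumps_inside:
  fixes u :: "'i \<Rightarrow> 'a::real_normed_vector"
  assumes "finite C" "\<And>i. i \<in> C \<Longrightarrow> 0 < r i"
    "pairwise (\<lambda>i j. disjnt (cball (a i) (r i)) (cball (a j) (r j))) C"
    "i \<in> C" "s \<in> cball (a i) (r i)"
  shows "(\<Sum>j\<in>C. bump ((s - a j) / r j) *\<^sub>R u j) = bump ((s - a i) / r i) *\<^sub>R u i"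
    "(\<Sum>j\<in>C. (bump_deriv ((s - a j) / r j) / r j) *\<^sub>R u j)
       = (bump_deriv ((s - a i) / r i) / r i) *\<^sub>R u i"
proof -
  have "r j \<le> \<bar>s - a j\<bar>" if "j \<in> C - {i}" for j
  proof -
    have "disjnt (cball (a i) (r i)) (cball (a j) (r j))"
      using assms(3,4) that by (auto simp: pairwise_def)
    then have "s \<notin> cball (a j) (r j)" using assms(5) by (auto simp: disjnt_iff)
    then show ?thesis by (simp add: dist_real_def abs_minus_commute)
  qed
  have "(\<Sum>j\<in>C - {i}. bump ((s - a j) / r j) *\<^sub>R u j) = 0"
    "(\<Sum>j\<in>C - {i}. (bump_deriv ((s - a j) / r j) / r j) *\<^sub>R u j) = 0"
    using \<open>\<And>j. j \<in> C - {i} \<Longrightarrow> r j \<le> \<bar>s - a j\<bar>\<close> assms(2) by (intro sum_bumps_outside; simp)+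
  then show "(\<Sum>j\<in>C. bump ((s - a j) / r j) *\<^sub>R u j) = bump ((s - a i) / r i) *\<^sub>R u i"
    "(\<Sum>j\<in>C. (bump_deriv ((s - a j) / r j) / r j) *\<^sub>R u j)
       = (bump_deriv ((s - a i) / r i) / r i) *\<^sub>R u i"
    by (simp_all add: sum.remove[OF assms(1,4)])
qed

section \<open>Time spent in a closed set\<close>

lemma c1_apply_plus: "c1_apply (f + g) t = c1_apply f t + c1_apply g t"
  by (simp add: plus_c1.rep_eq)

lemma c1_lipschitz:
  assumes L: "\<And>t. t \<in> {0..1} \<Longrightarrow> norm (c1_deriv \<gamma> t) \<le> L" and st: "s \<in> {0..1}" "t \<in> {0..1}"
  shows "norm (c1_apply \<gamma> s - c1_apply \<gamma> t) \<le> L * \<bar>s - t\<bar>"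
proof -
  have "norm (c1_apply \<gamma> s - c1_apply \<gamma> t) \<le> L * norm (s - t)"
  proof (rule differentiable_bound[of "{0..1}" "c1_apply \<gamma>" "\<lambda>t x. x *\<^sub>R c1_deriv \<gamma> t"])
    fix x :: real assume x: "x \<in> {0..1}"
    show "(c1_apply \<gamma> has_derivative (\<lambda>y. y *\<^sub>R c1_deriv \<gamma> x)) (at x within {0..1})"
      using c1_has_deriv[OF x, of \<gamma>] unfolding has_vector_derivative_def .
    show "onorm (\<lambda>y. y *\<^sub>R c1_deriv \<gamma> x) \<le> L"
    proof (rule onorm_le)
      show "norm (y *\<^sub>R c1_deriv \<gamma> x) \<le> L * norm y" for y
        using mult_left_mono[OF L[OF x] abs_ge_zero[of y]] by (simp add: mult.commute)
    qed
  qed (use st in auto)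
  then show ?thesis by simp
qed

definition hit_measure :: "'a::real_normed_vector set \<Rightarrow> 'a c1 \<Rightarrow> real" where
  "hit_measure F \<gamma> = measure lebesgue {t \<in> {0..1}. c1_apply \<gamma> t \<in> F}"

lemma compact_hit:
  assumes "closed F"
  shows "compact {t \<in> {0..1}. c1_apply \<gamma> t \<in> F}"
proof -
  have "closed ({0..1} \<inter> c1_apply \<gamma> -` F)"
    by (rule continuous_closed_preimage[OF continuous_on_c1_apply _ assms]) simp
  moreover have "{t \<in> {0..1}. c1_apply \<gamma> t \<in> F} = {0..1} \<inter> ({0..1} \<inter> c1_apply \<gamma> -` F)"
    by auto
  ultimately show ?thesis
    by (metis compact_Int_closed compact_Icc)
qed

text \<open>The times in \<open>F\<close> form a compact set, hence have an open neighbourhood \<open>V\<close> of almost the same measure.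
  Outside \<open>V\<close> the curve keeps a positive distance \<open>d\<close> from \<open>F\<close>, by compactness. So a uniformly small
  perturbation can meet \<open>F\<close> only within \<open>V\<close>. This single fact gives the upper semicontinuity of the
  hitting time and controls the times at which a perturbation may newly enter \<open>F\<close>.\<close>

lemma hit_open_neighbourhood:
  fixes \<gamma> :: "'a::real_normed_vector c1"
  assumes "closed F" "0 < \<theta>"
  obtains V d where "open V" "{t \<in> {0..1}. c1_apply \<gamma> t \<in> F} \<subseteq> V" "V \<in> lmeasurable"
    "measure lebesgue V < hit_measure F \<gamma> + \<theta>" "0 < d"
    "\<And>\<beta> t. \<lbrakk>t \<in> {0..1}; dist (c1_apply \<beta> t) (c1_apply \<gamma> t) < d; c1_apply \<beta> t \<in> F\<rbrakk> \<Longrightarrow> t \<in> V"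
proof -
  let ?K = "{t \<in> {0..1}. c1_apply \<gamma> t \<in> F}"
  have "?K \<in> lmeasurable" using compact_hit[OF assms(1)] by (rule lmeasurable_compact)
  obtain V where V: "open V" "?K \<subseteq> V" "V - ?K \<in> lmeasurable"
    "emeasure lebesgue (V - ?K) < ennreal \<theta>"
    by (rule sets_lebesgue_outer_open[OF fmeasurableD[OF \<open>?K \<in> lmeasurable\<close>] assms(2)])
  have V3: "V \<in> lmeasurable"
    using fmeasurable.Un[OF \<open>?K \<in> lmeasurable\<close> V(3)] V(2) by (simp add: Un_absorb1)
  have "measure lebesgue (V - ?K) < \<theta>"
    using V(3,4) assms(2) by (simp add: emeasure_eq_measure2 ennreal_less_iff)
  then have V4: "measure lebesgue V < measure lebesgue ?K + \<theta>"
    using measurable_measure_Diff[OF V3 fmeasurableD[OF \<open>?K \<in> lmeasurable\<close>] V(2)] by linarith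
  have K: "compact (c1_apply \<gamma> ` ({0..1} - V))"
    by (intro compact_continuous_image continuous_on_subset[OF continuous_on_c1_apply] compact_diff V) auto
  have disj: "x \<notin> F" if "x \<in> c1_apply \<gamma> ` ({0..1} - V)" for x using V(2) that by auto
  have "\<exists>d>0. \<forall>x \<in> c1_apply \<gamma> ` ({0..1} - V). \<forall>y\<in>F. d \<le> dist x y"
  proof (cases "F = {} \<or> {0..1} - V = {}")
    case True
    then show ?thesis by (auto intro: exI[of _ 1])
  next
    case False
    have "continuous_on (c1_apply \<gamma> ` ({0..1} - V)) (\<lambda>x. infdist x F)"
      by (intro continuous_on_infdist continuous_on_id)
    then obtain x where x: "x \<in> c1_apply \<gamma> ` ({0..1} - V)"
      "\<And>y. y \<in> c1_apply \<gamma> ` ({0..1} - V) \<Longrightarrow> infdist x F \<le> infdist y F"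
      using continuous_attains_inf[OF K, of "\<lambda>x. infdist x F"] False
      by (metis image_is_empty)
    have "infdist x F \<noteq> 0"
      using in_closed_iff_infdist_zero[OF assms(1)] disj[OF x(1)] False by blast
    then have "0 < infdist x F" using infdist_nonneg[of x F] by linarith
    moreover have "infdist x F \<le> dist z y" if "z \<in> c1_apply \<gamma> ` ({0..1} - V)" "y \<in> F" for z y
      using x(2)[OF that(1)] infdist_le[OF that(2), of z] by linarith
    ultimately show ?thesis by blast
  qed
  then obtain d where "0 < d" "\<And>x y. x \<in> c1_apply \<gamma> ` ({0..1} - V) \<Longrightarrow> y \<in> F \<Longrightarrow> d \<le> dist x y"
    by blast
  then have "t \<in> V" if "t \<in> {0..1}" "dist (c1_apply \<beta> t) (c1_apply \<gamma> t) < d" "c1_apply \<beta> t \<in> F" for \<beta> t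
    using that by (metis DiffI dist_commute imageI not_less)
  then show thesis using that V(1,2) V3 V4 \<open>0 < d\<close> unfolding hit_measure_def by blast
qed

lemma hit_measure_avoiding:
  fixes \<gamma> :: "'a::real_normed_vector c1"
  assumes "closed F" "V \<in> lmeasurable" "W \<in> lmeasurable" "W \<subseteq> V"
    and "\<And>t. \<lbrakk>t \<in> {0..1}; c1_apply \<gamma> t \<in> F\<rbrakk> \<Longrightarrow> t \<in> V - W"
  shows "hit_measure F \<gamma> \<le> measure lebesgue V - measure lebesgue W"
proof -
  have "hit_measure F \<gamma> \<le> measure lebesgue (V - W)"
    unfolding hit_measure_def
    by (rule measure_mono_fmeasurable)
       (use assms lmeasurable_compact[OF compact_hit[OF assms(1), of \<gamma>]] in \<open>auto intro: fmeasurableD fmeasurable.Diff\<close>)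
  also have "\<dots> = measure lebesgue V - measure lebesgue W"
    using measurable_measure_Diff[OF assms(2) fmeasurableD[OF assms(3)] assms(4)] .
  finally show ?thesis .
qed

section \<open>The energy of a curve\<close>

definition energy :: "'a::real_normed_vector c1 \<Rightarrow> real" where
  "energy \<gamma> = integral {0..1} (\<lambda>t. (norm (c1_deriv \<gamma> t))\<^sup>2)"

lemma energy_integrable: "(\<lambda>t. (norm (c1_deriv \<gamma> t))\<^sup>2) integrable_on {0..1}"
  by (intro integrable_continuous_interval continuous_intros continuous_on_c1_deriv)

lemma energy_nonneg: "0 \<le> energy \<omega>"
  unfolding energy_def by (intro integral_nonneg energy_integrable) simp

lemma energy_add_le:
  "energy (\<omega> + v) \<le> energy \<omega> + (2 * norm \<omega> * norm v + (norm v)\<^sup>2)"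
proof (rule has_integral_le)
  show "((\<lambda>t. (norm (c1_deriv (\<omega> + v) t))\<^sup>2) has_integral energy (\<omega> + v)) {0..1}"
    unfolding energy_def by (rule integrable_integral[OF energy_integrable])
  have const: "((\<lambda>t::real. B) has_integral B) {0..1}" for B :: real
    using has_integral_const_real[of B 0 1] by simp
  show "((\<lambda>t. (norm (c1_deriv \<omega> t))\<^sup>2 + (2 * norm \<omega> * norm v + (norm v)\<^sup>2)) has_integral
      energy \<omega> + (2 * norm \<omega> * norm v + (norm v)\<^sup>2)) {0..1}"
    unfolding energy_def by (rule has_integral_add[OF integrable_integral[OF energy_integrable] const])
  fix t :: real assume t: "t \<in> {0..1}"
  have "norm (c1_deriv (\<omega> + v) t) \<le> norm (c1_deriv \<omega> t) + norm v"
    using norm_triangle_ineq[of "c1_deriv \<omega> t" "c1_deriv v t"] norm_c1_deriv_le[OF t, of v] t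
    by (simp add: c1_deriv_plus)
  then have "(norm (c1_deriv (\<omega> + v) t))\<^sup>2 \<le> (norm (c1_deriv \<omega> t) + norm v)\<^sup>2"
    by (intro power_mono) auto
  also have "\<dots> = (norm (c1_deriv \<omega> t))\<^sup>2 + (2 * norm (c1_deriv \<omega> t) * norm v + (norm v)\<^sup>2)"
    by (simp add: power2_sum)
  also have "\<dots> \<le> (norm (c1_deriv \<omega> t))\<^sup>2 + (2 * norm \<omega> * norm v + (norm v)\<^sup>2)"
    using norm_c1_deriv_le[OF t, of \<omega>] by (intro add_left_mono add_right_mono mult_right_mono) auto
  finally show "(norm (c1_deriv (\<omega> + v) t))\<^sup>2 \<le> (norm (c1_deriv \<omega> t))\<^sup>2 + (2 * norm \<omega> * norm v + (norm v)\<^sup>2)" .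
qed

text \<open>The hitting time is only upper semicontinuous: a curve may touch \<open>F\<close> for a long time and leave it under an
  arbitrarily small perturbation. The energy is continuous.\<close>

lemma hit_measure_plus_energy_upper_semicontinuous:
  fixes \<gamma> \<gamma>0 :: "'a::real_normed_vector c1"
  assumes "closed F" "0 \<le> lam" "hit_measure F \<gamma> + lam * energy (\<gamma> - \<gamma>0) < x"
  obtains \<zeta> where "0 < \<zeta>"
    "\<And>\<beta>. dist \<beta> \<gamma> < \<zeta> \<Longrightarrow> hit_measure F \<beta> + lam * energy (\<beta> - \<gamma>0) < x"
proof -
  define g where "g = (x - (hit_measure F \<gamma> + lam * energy (\<gamma> - \<gamma>0))) / 2"
  have "0 < g" using assms(3) by (simp add: g_def)
  obtain V d where V: "V \<in> lmeasurable" "measure lebesgue V < hit_measure F \<gamma> + g" "0 < d"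
    and Vd: "\<And>\<beta> t. \<lbrakk>t \<in> {0..1}; dist (c1_apply \<beta> t) (c1_apply \<gamma> t) < d; c1_apply \<beta> t \<in> F\<rbrakk> \<Longrightarrow> t \<in> V"
    by (rule hit_open_neighbourhood[where F = F and \<gamma> = \<gamma>, OF assms(1) \<open>0 < g\<close>]) blast
  \<comment> \<open>The summand 1 only makes \<open>A\<close> positive when \<open>lam = 0\<close>.\<close>
  define A where "A = lam * (2 * norm (\<gamma> - \<gamma>0) + 1) + 1"
  have "0 < A" using assms(2) by (simp add: A_def add_nonneg_pos)
  define \<zeta> where "\<zeta> = min d (min 1 (g / A))"
  have "0 < \<zeta>" using V(3) \<open>0 < g\<close> \<open>0 < A\<close> by (simp add: \<zeta>_def)
  moreover have "hit_measure F \<beta> + lam * energy (\<beta> - \<gamma>0) < x" if \<beta>: "dist \<beta> \<gamma> < \<zeta>" for \<beta>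
  proof -
    define z where "z = norm (\<beta> - \<gamma>)"
    have z: "0 \<le> z" "z < d" "z < 1" "z * A < g"
      using \<beta> \<open>0 < A\<close> by (auto simp: z_def \<zeta>_def dist_norm pos_less_divide_eq)
    have "hit_measure F \<beta> \<le> measure lebesgue V - measure lebesgue ({} :: real set)"
    proof (rule hit_measure_avoiding[OF assms(1) V(1)])
      fix t :: real assume t: "t \<in> {0..1}" "c1_apply \<beta> t \<in> F"
      have "dist (c1_apply \<beta> t) (c1_apply \<gamma> t) < d"
        using norm_c1_apply_le[OF t(1), of "\<beta> - \<gamma>"] z(2) by (simp add: z_def dist_norm c1_apply_diff)
      from Vd[OF t(1) this t(2)] show "t \<in> V - {}" by simp
    qed auto
    then have 1: "hit_measure F \<beta> < hit_measure F \<gamma> + g" using V(2) by simp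
    have "energy (\<beta> - \<gamma>0) = energy ((\<gamma> - \<gamma>0) + (\<beta> - \<gamma>))" by simp
    also have "\<dots> \<le> energy (\<gamma> - \<gamma>0) + (2 * norm (\<gamma> - \<gamma>0) * z + z\<^sup>2)"
      unfolding z_def by (rule energy_add_le)
    also have "z\<^sup>2 \<le> 1 * z"
      unfolding power2_eq_square using z by (intro mult_right_mono) auto
    finally have "energy (\<beta> - \<gamma>0) \<le> energy (\<gamma> - \<gamma>0) + z * (2 * norm (\<gamma> - \<gamma>0) + 1)"
      by (simp add: algebra_simps)
    then have "lam * energy (\<beta> - \<gamma>0) \<le> lam * (energy (\<gamma> - \<gamma>0) + z * (2 * norm (\<gamma> - \<gamma>0) + 1))"
      using assms(2) by (rule mult_left_mono)
    also have "\<dots> = lam * energy (\<gamma> - \<gamma>0) + z * A - z" by (simp add: A_def algebra_simps)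
    finally have "lam * energy (\<beta> - \<gamma>0) < lam * energy (\<gamma> - \<gamma>0) + g" using z by linarith
    then show ?thesis using 1 by (simp add: g_def field_simps)
  qed
  ultimately show thesis using that by blast
qed

text \<open>This is Chebyshev's inequality. It bounds the set of times at which the minimisation leaves no room for
  a further change of the derivative.\<close>

lemma large_derivative_measure_le_energy:
  fixes \<omega> :: "'a::real_normed_vector c1"
  assumes "0 \<le> M"
  shows "{t \<in> {0..1}. M \<le> norm (c1_deriv \<omega> t)} \<in> lmeasurable" (is "?B \<in> _")
    and "M\<^sup>2 * measure lebesgue {t \<in> {0..1}. M \<le> norm (c1_deriv \<omega> t)} \<le> energy \<omega>"
proof -
  have "closed ({0..1} \<inter> (\<lambda>t. norm (c1_deriv \<omega> t)) -` {M..})"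
    by (intro continuous_closed_preimage continuous_on_norm continuous_on_c1_deriv) auto
  then have "compact ({0..1} \<inter> ({0..1} \<inter> (\<lambda>t. norm (c1_deriv \<omega> t)) -` {M..}))"
    by (intro compact_Int_closed) auto
  moreover have "{0..1} \<inter> ({0..1} \<inter> (\<lambda>t. norm (c1_deriv \<omega> t)) -` {M..}) = ?B" by auto
  ultimately show B: "?B \<in> lmeasurable" using lmeasurable_compact by metis
  have B': "?B \<inter> {0..1} = ?B" by auto
  have "(indicat_real ?B has_integral measure lebesgue ?B) {0..1}"
    using integrable_integral[OF integrable_on_indicator[of ?B "{0..1}", THEN iffD2]]
      integral_indicator[of ?B "{0..1}"] B unfolding B' by metis
  then have i: "((\<lambda>t. M\<^sup>2 * indicat_real ?B t) has_integral M\<^sup>2 * measure lebesgue ?B) {0..1}"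
    by (rule has_integral_mult_right)
  have e: "((\<lambda>t. (norm (c1_deriv \<omega> t))\<^sup>2) has_integral energy \<omega>) {0..1}"
    unfolding energy_def by (rule integrable_integral[OF energy_integrable])
  show "M\<^sup>2 * measure lebesgue ?B \<le> energy \<omega>"
  proof (rule has_integral_le[OF i e])
    fix t :: real assume "t \<in> {0..1}"
    show "M\<^sup>2 * indicat_real ?B t \<le> (norm (c1_deriv \<omega> t))\<^sup>2"
      using assms by (cases "t \<in> ?B") (auto intro: power_mono)
  qed
qed

text \<open>Expanding the square, the increase of the energy consists of a cross term and of the energy of the bumps,
  and the latter is of order \<open>\<epsilon>\<^sup>2\<close> times the total length. In the cross term \<open>\<omega>'\<close> may be replaced on each interval
  by its value at the centre, at the cost of another \<open>\<epsilon>\<^sup>2\<close>; what remains is the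
  derivative of a function that vanishes at both end points of \<open>[0,1]\<close>, so its integral is zero. Thus slopes of order
  \<open>\<epsilon>\<close> cost only \<open>\<epsilon>\<^sup>2\<close>.\<close>

lemma energy_bumps:
  fixes \<omega> :: "'h::real_inner c1" and a r :: "'i \<Rightarrow> real" and u :: "'i \<Rightarrow> 'h"
  assumes C: "finite C" and r: "\<And>i. i \<in> C \<Longrightarrow> 0 < r i"
    and pw: "pairwise (\<lambda>i j. disjnt (cball (a i) (r i)) (cball (a j) (r j))) C"
    and sub: "\<And>i. i \<in> C \<Longrightarrow> cball (a i) (r i) \<subseteq> {0<..<1}"
    and u: "\<And>i. i \<in> C \<Longrightarrow> norm (u i) \<le> \<epsilon> * r i"
    and osc: "\<And>i s. \<lbrakk>i \<in> C; s \<in> cball (a i) (r i)\<rbrakk> \<Longrightarrow>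
                norm (c1_deriv \<omega> s - c1_deriv \<omega> (a i)) \<le> \<epsilon>"
  shows "energy (\<omega> + bumps C a r u) \<le> energy \<omega> + 8 * \<epsilon>\<^sup>2 * (\<Sum>i\<in>C. 2 * r i)"
proof -
  let ?U = "\<Union>i\<in>C. cball (a i) (r i)"
  define v' where "v' s = (\<Sum>i\<in>C. (bump_deriv ((s - a i) / r i) / r i) *\<^sub>R u i)" for s
  \<comment> \<open>\<open>\<Psi>\<close> is the primitive of the cross term with \<open>\<omega>'\<close> frozen at the centres of the intervals.\<close>
  define \<Psi> where "\<Psi> s = (\<Sum>i\<in>C. bump ((s - a i) / r i) *\<^sub>R (2 * inner (c1_deriv \<omega> (a i)) (u i)))" for s
  define \<Psi>' where "\<Psi>' s = (\<Sum>i\<in>C. (bump_deriv ((s - a i) / r i) / r i) *\<^sub>R (2 * inner (c1_deriv \<omega> (a i)) (u i)))" for s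
  have deriv: "c1_deriv (\<omega> + bumps C a r u) s = c1_deriv \<omega> s + v' s" if "s \<in> {0..1}" for s
    using that by (simp add: c1_deriv_plus c1_deriv_bumps v'_def)
  have \<Psi>0: "\<Psi> s = 0" if "s = 0 \<or> s = 1" for s
    unfolding \<Psi>_def
  proof (rule sum_bumps_outside(1)[OF r])
    fix i assume "i \<in> C"
    moreover have "s \<notin> {0<..<1}" using that by auto
    ultimately have "s \<notin> cball (a i) (r i)" using sub by blast
    then show "r i \<le> \<bar>s - a i\<bar>" by (simp add: dist_real_def abs_minus_commute)
  qed
  have "(\<Psi>' has_integral (\<Psi> 1 - \<Psi> 0)) {0..1}"
    unfolding \<Psi>_def[abs_def] \<Psi>'_def[abs_def]
    by (rule fundamental_theorem_of_calculus[OF zero_le_one sum_bump_has_derivative])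
  then have int1: "(\<Psi>' has_integral 0) {0..1}" by (simp add: \<Psi>0)
  have "?U \<in> lmeasurable" using C by (intro fmeasurable.finite_UN lmeasurable_compact) auto
  moreover have "?U \<subseteq> {0..1}" using sub by force
  ultimately have U: "?U \<inter> {0..1} \<in> lmeasurable" "?U \<inter> {0..1} = ?U" by (simp_all add: Int_absorb2)
  have "measure lebesgue ?U = (\<Sum>i\<in>C. measure lebesgue (cball (a i) (r i)))"
    by (rule measure_UNION'[OF C lmeasurable_compact[OF compact_cball] pw])
  also have "\<dots> = (\<Sum>i\<in>C. 2 * r i)"
    using r by (intro sum.cong refl measure_lebesgue_cball_real) (auto simp: less_imp_le)
  finally have mU: "measure lebesgue ?U = (\<Sum>i\<in>C. 2 * r i)" .
  have int2: "(indicat_real ?U has_integral (\<Sum>i\<in>C. 2 * r i)) {0..1}"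
    using integrable_integral[OF integrable_on_indicator[of ?U "{0..1}", THEN iffD2, OF U(1)]]
      integral_indicator[OF U(1)] U(2) mU by simp
  have int3: "((\<lambda>s. (norm (c1_deriv \<omega> s))\<^sup>2 + \<Psi>' s + 8 * \<epsilon>\<^sup>2 * indicat_real ?U s) has_integral
                 energy \<omega> + 0 + 8 * \<epsilon>\<^sup>2 * (\<Sum>i\<in>C. 2 * r i)) {0..1}"
    unfolding energy_def
    by (intro has_integral_add has_integral_mult_right int1 int2 integrable_integral energy_integrable)
  have le: "(norm (c1_deriv \<omega> s + v' s))\<^sup>2 \<le> (norm (c1_deriv \<omega> s))\<^sup>2 + \<Psi>' s + 8 * \<epsilon>\<^sup>2 * indicat_real ?U s"
    if "s \<in> {0..1}" for s
  proof (cases "s \<in> ?U")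
    case True
    then obtain i where i: "i \<in> C" "s \<in> cball (a i) (r i)" by blast
    let ?w = "c1_deriv \<omega> s" and ?wc = "c1_deriv \<omega> (a i)"
    define b where "b = bump_deriv ((s - a i) / r i) / r i"
    have v': "v' s = b *\<^sub>R u i"
      unfolding v'_def b_def by (rule sum_bumps_inside(2)[OF C r pw i])
    have \<Psi>': "\<Psi>' s = b * (2 * inner ?wc (u i))"
      unfolding \<Psi>'_def b_def
      using sum_bumps_inside(2)[OF C r pw i, of "\<lambda>i. 2 * inner (c1_deriv \<omega> (a i)) (u i)"]
      by (simp only: real_scaleR_def)
    have "0 < r i" using r[OF i(1)] .
    have "\<bar>b\<bar> \<le> 2 / r i"
      using bump_deriv_le_2[of "(s - a i) / r i"] \<open>0 < r i\<close> by (simp add: b_def abs_divide divide_right_mono)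
    then have "norm (v' s) \<le> 2 / r i * (\<epsilon> * r i)"
      unfolding v' norm_scaleR using u[OF i(1)] \<open>0 < r i\<close> by (intro mult_mono) auto
    then have nv: "norm (v' s) \<le> 2 * \<epsilon>" using \<open>0 < r i\<close> by simp
    have "0 \<le> \<epsilon>" using nv norm_ge_zero[of "v' s"] by linarith
    have "inner (?w - ?wc) (v' s) \<le> norm (?w - ?wc) * norm (v' s)" by (rule norm_cauchy_schwarz)
    also have "\<dots> \<le> \<epsilon> * (2 * \<epsilon>)"
      using osc[OF i] nv \<open>0 \<le> \<epsilon>\<close> by (intro mult_mono) auto
    finally have 1: "inner (?w - ?wc) (v' s) \<le> 2 * \<epsilon>\<^sup>2" by (simp add: power2_eq_square)
    have 2: "(norm (v' s))\<^sup>2 \<le> 4 * \<epsilon>\<^sup>2"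
      using power_mono[OF nv norm_ge_zero, of 2] by (simp add: power_mult_distrib)
    have "(norm (?w + v' s))\<^sup>2 = (norm ?w)\<^sup>2 + 2 * inner ?w (v' s) + (norm (v' s))\<^sup>2"
      by (simp add: power2_norm_eq_inner inner_add_left inner_add_right inner_commute)
    also have "2 * inner ?w (v' s) = 2 * inner (?w - ?wc) (v' s) + \<Psi>' s"
      by (simp add: \<Psi>' v' inner_diff_left algebra_simps)
    finally have "(norm (?w + v' s))\<^sup>2 \<le> (norm ?w)\<^sup>2 + \<Psi>' s + 8 * \<epsilon>\<^sup>2"
      using 1 2 by linarith
    then show ?thesis using True by (simp add: indicator_def)
  next
    case False
    have far: "r i \<le> \<bar>s - a i\<bar>" if "i \<in> C" for i
    proof -
      have "s \<notin> cball (a i) (r i)" using False that by blast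
      then show ?thesis by (simp add: dist_real_def abs_minus_commute)
    qed
    have "v' s = 0"
      unfolding v'_def by (rule sum_bumps_outside(2)[OF r far])
    moreover have "\<Psi>' s = 0"
      unfolding \<Psi>'_def by (rule sum_bumps_outside(2)[OF r far])
    ultimately show ?thesis using False by simp
  qed
  have "energy (\<omega> + bumps C a r u) \<le> energy \<omega> + 0 + 8 * \<epsilon>\<^sup>2 * (\<Sum>i\<in>C. 2 * r i)"
  proof (rule has_integral_le)
    show "((\<lambda>s. (norm (c1_deriv (\<omega> + bumps C a r u) s))\<^sup>2) has_integral energy (\<omega> + bumps C a r u)) {0..1}"
      unfolding energy_def by (rule integrable_integral[OF energy_integrable])
  qed (use int3 le deriv in auto)
  then show ?thesis by simp
qed

section \<open>Pushing a curve into the holes of a porous set\<close>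

text \<open>Here \<open>\<omega>\<close> is an arbitrary curve, later the difference of \<open>\<gamma>\<close> and the reference curve. Over each of the chosen
  intervals, of radius \<open>\<rho>/\<epsilon>\<close>, the bump moves \<open>\<gamma> t\<close> exactly to the centre of a hole at distance \<open>\<rho>\<close>.
  The curve \<open>\<gamma>\<close> has speed at most \<open>L\<close> and the bump has height at least \<open>1 - 2 \<epsilon> |s - t| / \<rho>\<close> relative to its top, so
  the perturbed curve stays in the hole while \<open>|s - t| \<le> c \<rho> / (L + 2)\<close>. This is a fixed proportion,
  of order \<open>\<epsilon>\<close>, of the interval.\<close>

lemma porous_improvement:
  fixes E :: "'h::real_inner set" and \<gamma> \<omega> :: "'h c1"
  assumes por: "c_porous c E" "0 < c" "c < 1"
    and L: "\<And>t. t \<in> {0..1} \<Longrightarrow> norm (c1_deriv \<gamma> t) \<le> L"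
    and eps: "0 < \<epsilon>" "\<epsilon> \<le> 1" and "0 < \<eta>" "0 < \<theta>"
    and G: "G \<subseteq> {0<..<1}" "\<And>t. t \<in> G \<Longrightarrow> c1_apply \<gamma> t \<in> E"
      "\<And>t. t \<in> G \<Longrightarrow> norm (c1_deriv \<omega> t) \<le> M"
    and outer: "ennreal \<alpha> < outer_measure_of lebesgue G" "0 \<le> \<alpha>"
  obtains v :: "'h c1" and \<sigma> where
    "\<And>t. t \<in> {0..1} \<Longrightarrow> norm (c1_apply v t) < \<eta>"
    "\<And>t. t \<in> {0..1} \<Longrightarrow> norm (c1_deriv (\<omega> + v) t) \<le> max (norm (c1_deriv \<omega> t)) (M + 3 * \<epsilon>)"
    "\<alpha> < \<sigma>"
    "hit_measure (closure E) (\<gamma> + v) \<le> hit_measure (closure E) \<gamma> + \<theta> - c / (L + 2) * \<epsilon> * \<sigma>"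
    "energy (\<omega> + v) \<le> energy \<omega> + 8 * \<epsilon>\<^sup>2 * \<sigma>"
proof -
  let ?F = "closure E"
  obtain V d where V: "open V" "{t \<in> {0..1}. c1_apply \<gamma> t \<in> ?F} \<subseteq> V" "V \<in> lmeasurable"
    "measure lebesgue V < hit_measure ?F \<gamma> + \<theta>" "0 < d"
    and Vd: "\<And>\<beta> t. \<lbrakk>t \<in> {0..1}; dist (c1_apply \<beta> t) (c1_apply \<gamma> t) < d; c1_apply \<beta> t \<in> ?F\<rbrakk> \<Longrightarrow> t \<in> V"
    by (rule hit_open_neighbourhood[where F = "closure E" and \<gamma> = \<gamma>, OF closed_closure \<open>0 < \<theta>\<close>]) blast
  have "uniformly_continuous_on {0..1} (c1_deriv \<omega>)"
    by (intro compact_uniformly_continuous continuous_on_c1_deriv) simp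
  then obtain d' where "0 < d'" and d': "\<And>s t. \<lbrakk>s \<in> {0..1}; t \<in> {0..1}; dist s t < d'\<rbrakk> \<Longrightarrow>
      dist (c1_deriv \<omega> s) (c1_deriv \<omega> t) < \<epsilon>"
    using eps(1) unfolding uniformly_continuous_on_def by (metis dist_commute)
  have "0 \<le> L" using L[of 0] norm_ge_zero[of "c1_deriv \<gamma> 0"] by (simp del: norm_ge_zero)
  define \<kappa> where "\<kappa> = c / (L + 2)"
  have \<kappa>: "0 < \<kappa>" "\<kappa> \<le> 1" "\<kappa> * (L + 2) = c"
    using por \<open>0 \<le> L\<close> by (auto simp: \<kappa>_def field_simps)
  define \<rho> where "\<rho> = (\<lambda>(t, h). dist (c1_apply \<gamma> t) h)"
  define r where "r i = \<rho> i / \<epsilon>" for i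
  define a :: "real \<times> 'h \<Rightarrow> real" where "a = fst"
  define u where "u = (\<lambda>(t, h). h - c1_apply \<gamma> t)"
  \<comment> \<open>An index is a time together with the centre of a hole: one time may need holes at many scales.
    Keeping \<open>\<rho>\<close> below \<open>d\<close> and the intervals inside \<open>V\<close> ensures that the perturbed curve
    meets \<open>F\<close> only within \<open>V\<close>, with the parts inside the holes removed from \<open>V\<close>.\<close>
  define K where "K = {i. a i \<in> G \<and> (\<exists>R > c * \<rho> i. ball (snd i) R \<inter> E = {}) \<and> 0 < \<rho> i \<and> \<rho> i < min d \<eta>
      \<and> cball (a i) (r i) \<subseteq> V \<inter> {0<..<1} \<and> r i < d'}"
  have nu: "norm (u i) = \<rho> i" for i
    by (simp add: u_def \<rho>_def case_prod_unfold dist_norm norm_minus_commute)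
  have rpos: "0 < r i" if "i \<in> K" for i using that eps(1) by (simp add: K_def r_def)
  have \<rho>r: "\<rho> i = \<epsilon> * r i" for i using eps(1) by (simp add: r_def)
  have fine: "\<exists>i. i \<in> K \<and> x \<in> cball (a i) (r i) \<and> r i < e" if "x \<in> G" "0 < e" for x e
  proof -
    have xE: "c1_apply \<gamma> x \<in> E" and x01: "x \<in> {0<..<1}" using G that(1) by auto
    then have "x \<in> V" using V(2) closure_subset[of E] by auto
    then have "x \<in> V \<inter> {0<..<1}" using x01 by blast
    moreover have "open (V \<inter> {0<..<1})" using V(1) by (intro open_Int) auto
    ultimately obtain \<delta> where \<delta>: "0 < \<delta>" "cball x \<delta> \<subseteq> V \<inter> {0<..<1}"
      using open_contains_cball by metis
    define \<xi> where "\<xi> = min (min d \<eta>) (\<epsilon> * min \<delta> (min d' e))"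
    have "0 < \<xi>" using \<open>0 < d\<close> \<open>0 < \<eta>\<close> eps \<delta>(1) \<open>0 < d'\<close> \<open>0 < e\<close> by (simp add: \<xi>_def)
    moreover have "porous_at c E (c1_apply \<gamma> x)" using por(1) xE by (simp add: c_porous_def)
    ultimately obtain h R where h: "0 < R" "dist (c1_apply \<gamma> x) h < \<xi>" "ball h R \<inter> E = {}"
      "c * dist (c1_apply \<gamma> x) h < R"
      unfolding porous_at_def by blast
    have "h \<noteq> c1_apply \<gamma> x" using h(1,3) xE by (metis centre_in_ball disjoint_iff)
    then have pos: "0 < \<rho> (x, h)" by (simp add: \<rho>_def)
    have "\<rho> (x, h) < \<xi>" using h(2) by (simp add: \<rho>_def)
    then have lt: "\<rho> (x, h) < min d \<eta>" "\<rho> (x, h) < \<epsilon> * min \<delta> (min d' e)" by (auto simp: \<xi>_def)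
    from lt(2) have "r (x, h) < min \<delta> (min d' e)"
      unfolding r_def pos_divide_less_eq[OF eps(1)] by (simp only: mult.commute)
    then have rlt: "r (x, h) < \<delta>" "r (x, h) < d'" "r (x, h) < e" by auto
    have "cball x (r (x, h)) \<subseteq> cball x \<delta>" using rlt(1) by (intro subset_cball) simp
    then have sub: "cball x (r (x, h)) \<subseteq> V \<inter> {0<..<1}" using \<delta>(2) by blast
    have hole: "\<exists>R > c * \<rho> (x, h). ball h R \<inter> E = {}" using h by (auto simp: \<rho>_def)
    have "(x, h) \<in> K"
      using pos lt(1) rlt(2) sub hole that(1) by (simp add: K_def a_def)
    moreover have "x \<in> cball (a (x, h)) (r (x, h))"
      using pos eps(1) by (simp add: a_def r_def)
    ultimately show ?thesis using rlt(3) by blast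
  qed
  obtain C where C: "finite C" "C \<subseteq> K"
    "pairwise (\<lambda>i j. disjnt (cball (a i) (r i)) (cball (a j) (r j))) C"
    "\<alpha> < (\<Sum>i\<in>C. 2 * r i)"
    by (rule finite_Vitali_intervals[of K r G a, OF rpos fine outer])
  have CK: "i \<in> K" if "i \<in> C" for i using that C(2) by blast
  have rC: "0 < r i" if "i \<in> C" for i using rpos CK that by blast
  define v where "v = bumps C a r u"
  have inside: "c1_apply v s = bump ((s - a i) / r i) *\<^sub>R u i"
    "c1_deriv v s = (bump_deriv ((s - a i) / r i) / r i) *\<^sub>R u i"
    if "i \<in> C" "s \<in> cball (a i) (r i)" for i s
  proof -
    have "s \<in> {0..1}" using CK[OF that(1)] that(2) by (force simp: K_def)
    then show "c1_apply v s = bump ((s - a i) / r i) *\<^sub>R u i"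
      "c1_deriv v s = (bump_deriv ((s - a i) / r i) / r i) *\<^sub>R u i"
      using sum_bumps_inside[OF C(1) rC C(3) that]
      by (simp_all add: v_def c1_apply_bumps c1_deriv_bumps)
  qed
  have outside: "c1_apply v s = 0" "c1_deriv v s = 0"
    if "s \<in> {0..1}" "s \<notin> (\<Union>i\<in>C. cball (a i) (r i))" for s
  proof -
    have far: "r i \<le> \<bar>s - a i\<bar>" if "i \<in> C" for i
    proof -
      have "s \<notin> cball (a i) (r i)" using \<open>s \<notin> (\<Union>i\<in>C. cball (a i) (r i))\<close> that by blast
      then show ?thesis by (simp add: dist_real_def abs_minus_commute)
    qed
    from sum_bumps_outside[OF rC far] show "c1_apply v s = 0" "c1_deriv v s = 0"
      using that(1) by (simp_all add: v_def c1_apply_bumps c1_deriv_bumps)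
  qed
  have small: "norm (c1_apply v t) < min d \<eta>" if t: "t \<in> {0..1}" for t
  proof (cases "t \<in> (\<Union>i\<in>C. cball (a i) (r i))")
    case True
    then obtain i where i: "i \<in> C" "t \<in> cball (a i) (r i)" by blast
    have "norm (c1_apply v t) = bump ((t - a i) / r i) * \<rho> i"
      using inside(1)[OF i] bump_le_1(1) by (simp add: nu)
    also have "\<dots> \<le> 1 * \<rho> i"
      using bump_le_1(2) rC[OF i(1)] eps(1) by (intro mult_right_mono) (auto simp: \<rho>r)
    also have "\<dots> < min d \<eta>" using CK[OF i(1)] by (simp add: K_def)
    finally show ?thesis .
  next
    case False
    then show ?thesis using outside(1)[OF t] \<open>0 < d\<close> \<open>0 < \<eta>\<close> by simp
  qed
  have osc: "norm (c1_deriv \<omega> s - c1_deriv \<omega> (a i)) \<le> \<epsilon>" if "i \<in> C" "s \<in> cball (a i) (r i)" for i s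
  proof -
    have "cball (a i) (r i) \<subseteq> {0<..<1}" "r i < d'" using CK[OF that(1)] by (auto simp: K_def)
    moreover have "a i \<in> cball (a i) (r i)" using rC[OF that(1)] by simp
    moreover have "{0<..<1} \<subseteq> {0..1::real}" by auto
    ultimately have "s \<in> {0..1}" "a i \<in> {0..1}" "dist s (a i) < d'"
      using that(2) by (blast, blast, simp add: dist_commute)
    from d'[OF this] show ?thesis by (simp add: dist_norm)
  qed
  have slope: "norm (c1_deriv (\<omega> + v) t) \<le> max (norm (c1_deriv \<omega> t)) (M + 3 * \<epsilon>)"
    if t: "t \<in> {0..1}" for t
  proof (cases "t \<in> (\<Union>i\<in>C. cball (a i) (r i))")
    case True
    then obtain i where i: "i \<in> C" "t \<in> cball (a i) (r i)" by blast
    have "norm (c1_deriv v t) = \<bar>bump_deriv ((t - a i) / r i)\<bar> / r i * (\<epsilon> * r i)"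
      using inside(2)[OF i] rC[OF i(1)] by (simp add: nu \<rho>r)
    also have "\<dots> = \<bar>bump_deriv ((t - a i) / r i)\<bar> * \<epsilon>" using rC[OF i(1)] by simp
    also have "\<dots> \<le> 2 * \<epsilon>" using bump_deriv_le_2 eps(1) by (intro mult_right_mono) auto
    finally have 1: "norm (c1_deriv v t) \<le> 2 * \<epsilon>" .
    have 2: "norm (c1_deriv \<omega> (a i)) \<le> M" using CK[OF i(1)] G(3) by (simp add: K_def)
    have "norm (c1_deriv \<omega> t) \<le> norm (c1_deriv \<omega> (a i)) + norm (c1_deriv \<omega> t - c1_deriv \<omega> (a i))"
      by (rule norm_triangle_sub)
    moreover have "norm (c1_deriv (\<omega> + v) t) \<le> norm (c1_deriv \<omega> t) + norm (c1_deriv v t)"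
      using t by (simp add: c1_deriv_plus norm_triangle_ineq)
    ultimately show ?thesis using 1 2 osc[OF i] by linarith
  next
    case False
    then show ?thesis using outside(2)[OF t] t by (simp add: c1_deriv_plus)
  qed
  have en: "energy (\<omega> + v) \<le> energy \<omega> + 8 * \<epsilon>\<^sup>2 * (\<Sum>i\<in>C. 2 * r i)"
    unfolding v_def
    by (rule energy_bumps[OF C(1) rC C(3) _ _ osc]) (use CK in \<open>auto simp: K_def nu \<rho>r\<close>)
  \<comment> \<open>The times spent in the holes: the intervals shrunk by the factor \<open>\<kappa> \<epsilon>\<close>.\<close>
  define W where "W = (\<Union>i\<in>C. cball (a i) (\<kappa> * \<rho> i))"
  have \<kappa>\<rho>: "0 \<le> \<kappa> * \<rho> i" "\<kappa> * \<rho> i \<le> r i" if "i \<in> C" for i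
  proof -
    show "0 \<le> \<kappa> * \<rho> i" using rC[OF that] \<kappa> eps by (simp add: \<rho>r)
    have "\<kappa> * \<epsilon> \<le> 1 * 1" using \<kappa> eps by (intro mult_mono) auto
    then show "\<kappa> * \<rho> i \<le> r i"
      using mult_right_mono[of "\<kappa> * \<epsilon>" 1 "r i"] rC[OF that] by (simp add: \<rho>r)
  qed
  have Wsub: "cball (a i) (\<kappa> * \<rho> i) \<subseteq> cball (a i) (r i)" if "i \<in> C" for i
    using \<kappa>\<rho>(2)[OF that] by (rule subset_cball)
  have avoid: "c1_apply (\<gamma> + v) s \<notin> ?F" if i: "i \<in> C" and s: "s \<in> cball (a i) (\<kappa> * \<rho> i)" for i s
  proof -
    obtain h where ih: "i = (a i, h)" by (cases i) (simp add: a_def)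
    let ?t = "a i" and ?x = "(s - a i) / r i"
    have \<rho>i: "\<rho> i = norm (c1_apply \<gamma> ?t - h)" and ui: "u i = h - c1_apply \<gamma> ?t"
      by (subst ih, simp add: \<rho>_def u_def dist_norm)+
    have s': "s \<in> cball ?t (r i)" using Wsub[OF i] s by blast
    have sub: "cball ?t (r i) \<subseteq> {0..1}" using CK[OF i] by (force simp: K_def)
    have st: "\<bar>s - ?t\<bar> \<le> \<kappa> * \<rho> i" using s by (simp add: dist_real_def abs_minus_commute)
    have "?t \<in> cball ?t (r i)" using rC[OF i] by simp
    then have "?t \<in> {0..1}" "s \<in> {0..1}" using sub s' by blast+
    then have 1: "norm (c1_apply \<gamma> s - c1_apply \<gamma> ?t) \<le> L * \<bar>s - ?t\<bar>"
      by (intro c1_lipschitz L)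
    have "c1_apply \<gamma> ?t + c1_apply v s - h = (1 - bump ?x) *\<^sub>R (c1_apply \<gamma> ?t - h)"
      using inside(1)[OF i s'] by (simp add: ui algebra_simps)
    then have "norm (c1_apply \<gamma> ?t + c1_apply v s - h) = (1 - bump ?x) * \<rho> i"
      using bump_le_1(2)[of ?x] by (simp add: \<rho>i)
    also have "\<dots> \<le> 2 * \<bar>?x\<bar> * \<rho> i"
      using bump_near_1[of ?x] by (intro mult_right_mono) (auto simp: \<rho>i)
    also have "\<dots> = 2 * \<epsilon> * \<bar>s - ?t\<bar>"
      using rC[OF i] by (simp add: \<rho>r abs_divide)
    also have "\<dots> \<le> 2 * \<bar>s - ?t\<bar>" using eps by (intro mult_right_mono) auto
    finally have 2: "norm (c1_apply \<gamma> ?t + c1_apply v s - h) \<le> 2 * \<bar>s - ?t\<bar>" .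
    have "norm (c1_apply (\<gamma> + v) s - h)
        = norm ((c1_apply \<gamma> s - c1_apply \<gamma> ?t) + (c1_apply \<gamma> ?t + c1_apply v s - h))"
      by (simp add: c1_apply_plus algebra_simps)
    also have "\<dots> \<le> L * \<bar>s - ?t\<bar> + 2 * \<bar>s - ?t\<bar>"
      by (rule norm_triangle_mono[OF 1 2])
    also have "\<dots> = (L + 2) * \<bar>s - ?t\<bar>" by (simp add: algebra_simps)
    also have "\<dots> \<le> (L + 2) * (\<kappa> * \<rho> i)" using st \<open>0 \<le> L\<close> by (intro mult_left_mono) auto
    also have "\<dots> = c * \<rho> i" using \<kappa>(3) by (metis mult.assoc mult.commute)
    finally have 3: "norm (c1_apply (\<gamma> + v) s - h) \<le> c * \<rho> i" .
    have "\<exists>R > c * \<rho> i. ball (snd i) R \<inter> E = {}" using CK[OF i] by (simp add: K_def)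
    then obtain R where R: "c * \<rho> i < R" "ball h R \<inter> E = {}" using ih by (metis snd_conv)
    have "ball h R \<inter> ?F = {}" using R(2) by (simp add: open_Int_closure_eq_empty)
    moreover have "c1_apply (\<gamma> + v) s \<in> ball h R"
      using 3 R(1) by (simp add: dist_norm norm_minus_commute)
    ultimately show ?thesis by blast
  qed
  have Wm: "W \<in> lmeasurable"
    unfolding W_def using C(1) by (intro fmeasurable.finite_UN lmeasurable_compact) auto
  have WV: "W \<subseteq> V" unfolding W_def using Wsub CK by (force simp: K_def)
  have "hit_measure ?F (\<gamma> + v) \<le> measure lebesgue V - measure lebesgue W"
  proof (rule hit_measure_avoiding[OF closed_closure V(3) Wm WV])
    fix t :: real assume t: "t \<in> {0..1}" "c1_apply (\<gamma> + v) t \<in> ?F"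
    have "dist (c1_apply (\<gamma> + v) t) (c1_apply \<gamma> t) < d"
      using small[OF t(1)] by (simp add: dist_norm c1_apply_plus)
    from Vd[OF t(1) this t(2)] show "t \<in> V - W" using avoid t(2) by (auto simp: W_def)
  qed
  moreover have "measure lebesgue W = (\<Sum>i\<in>C. measure lebesgue (cball (a i) (\<kappa> * \<rho> i)))"
    unfolding W_def
  proof (rule measure_UNION'[OF C(1) lmeasurable_compact[OF compact_cball]])
    show "pairwise (\<lambda>i j. disjnt (cball (a i) (\<kappa> * \<rho> i)) (cball (a j) (\<kappa> * \<rho> j))) C"
      using C(3) Wsub unfolding pairwise_def by (meson disjnt_subset1 disjnt_subset2)
  qed
  moreover have "\<dots> = (\<Sum>i\<in>C. 2 * (\<kappa> * \<rho> i))"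
    using \<kappa>\<rho>(1) by (intro sum.cong refl measure_lebesgue_cball_real)
  moreover have "\<dots> = \<kappa> * \<epsilon> * (\<Sum>i\<in>C. 2 * r i)"
    by (simp add: sum_distrib_left \<rho>r mult_ac)
  ultimately have "hit_measure ?F (\<gamma> + v) \<le> hit_measure ?F \<gamma> + \<theta> - \<kappa> * \<epsilon> * (\<Sum>i\<in>C. 2 * r i)"
    using V(4) by linarith
  then show thesis
    using that[of v "\<Sum>i\<in>C. 2 * r i"] small slope C(4) en by (simp add: \<kappa>_def)
qed

section \<open>Category\<close>

text \<open>The neighbourhood \<open>B\<close> bounds the values and the derivatives separately rather than the norm, since a
  perturbation that leaves the large derivatives unchanged stays in \<open>B\<close> even though it
  slightly increases the supremum of the values.\<close>

lemma nowhere_dense_long_time_in_porous: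
  fixes E :: "'h::real_inner set"
  assumes por: "c_porous c E" "0 < c" "c < 1" and "0 < \<delta>"
  shows "nowhere_dense {\<gamma> :: 'h c1. ennreal \<delta> < outer_measure_of lebesgue {t \<in> {0..1}. c1_apply \<gamma> t \<in> E}}"
    (is "nowhere_dense ?N")
  unfolding nowhere_dense_def
proof (rule ccontr)
  assume "interior (closure ?N) \<noteq> {}"
  then obtain \<gamma>0 where "\<gamma>0 \<in> interior (closure ?N)" by blast
  then obtain e where "0 < e" and e: "ball \<gamma>0 e \<subseteq> closure ?N" unfolding mem_interior by auto
  define \<eta> where "\<eta> = e / 2"
  have "0 < \<eta>" using \<open>0 < e\<close> by (simp add: \<eta>_def)
  define B where "B = {\<gamma>. sup_norm (c1_apply (\<gamma> - \<gamma>0)) < \<eta> \<and> sup_norm (c1_deriv (\<gamma> - \<gamma>0)) < \<eta>}"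
  have "\<gamma>0 \<in> B"
  proof -
    have "sup_norm (c1_apply (0 :: 'h c1)) + sup_norm (c1_deriv (0 :: 'h c1)) = 0"
      using norm_zero[where 'a = "'h c1"] unfolding norm_c1_def .
    then have "sup_norm (c1_apply (0 :: 'h c1)) = 0" "sup_norm (c1_deriv (0 :: 'h c1)) = 0"
      using sup_norm_nonneg[OF continuous_on_c1_apply, of "0 :: 'h c1"]
        sup_norm_nonneg[OF continuous_on_c1_deriv, of "0 :: 'h c1"] by linarith+
    then show ?thesis using \<open>0 < \<eta>\<close> by (simp add: B_def)
  qed
  have "B \<subseteq> closure ?N"
  proof -
    have "B \<subseteq> ball \<gamma>0 e"
    proof
      fix \<beta> assume "\<beta> \<in> B"
      then have "norm (\<beta> - \<gamma>0) < e" by (simp add: B_def \<eta>_def norm_c1_def)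
      then show "\<beta> \<in> ball \<gamma>0 e" by (simp add: dist_norm norm_minus_commute)
    qed
    then show ?thesis using e by blast
  qed
  have Bopen: "\<exists>\<zeta>>0. \<forall>\<beta>. dist \<beta> \<gamma> < \<zeta> \<longrightarrow> \<beta> \<in> B" if "\<gamma> \<in> B" for \<gamma>
  proof -
    let ?A = "sup_norm (c1_apply (\<gamma> - \<gamma>0))" and ?D = "sup_norm (c1_deriv (\<gamma> - \<gamma>0))"
    have "\<beta> \<in> B" if \<beta>: "dist \<beta> \<gamma> < min (\<eta> - ?A) (\<eta> - ?D)" for \<beta>
    proof -
      have eq: "\<beta> - \<gamma>0 = (\<gamma> - \<gamma>0) + (\<beta> - \<gamma>)" by simp
      have "sup_norm (c1_apply (\<beta> - \<gamma>0)) \<le> ?A + norm (\<beta> - \<gamma>)"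
      proof (rule sup_norm_least)
        fix t :: real assume t: "t \<in> {0..1}"
        show "norm (c1_apply (\<beta> - \<gamma>0) t) \<le> ?A + norm (\<beta> - \<gamma>)"
          unfolding eq c1_apply_plus
          by (rule norm_triangle_mono[OF sup_norm_upper[OF continuous_on_c1_apply t] norm_c1_apply_le[OF t]])
      qed
      moreover have "sup_norm (c1_deriv (\<beta> - \<gamma>0)) \<le> ?D + norm (\<beta> - \<gamma>)"
      proof (rule sup_norm_least)
        fix t :: real assume t: "t \<in> {0..1}"
        show "norm (c1_deriv (\<beta> - \<gamma>0) t) \<le> ?D + norm (\<beta> - \<gamma>)"
          unfolding eq c1_deriv_plus[OF t]
          by (rule norm_triangle_mono[OF sup_norm_upper[OF continuous_on_c1_deriv t] norm_c1_deriv_le[OF t]])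
      qed
      ultimately show ?thesis using \<beta> by (simp add: B_def dist_norm)
    qed
    moreover have "0 < min (\<eta> - ?A) (\<eta> - ?D)" using that by (simp add: B_def)
    ultimately show ?thesis by blast
  qed
  \<comment> \<open>With this weight \<open>\<Phi> \<gamma> \<le> 2\<close> forces the energy below \<open>(\<eta>/2)\<^sup>2 \<cdot> \<delta>/2\<close>.\<close>
  define lam where "lam = 16 / (\<delta> * \<eta>\<^sup>2)"
  have "0 < lam" using \<open>0 < \<delta>\<close> \<open>0 < \<eta>\<close> by (simp add: lam_def)
  define \<Phi> where "\<Phi> \<gamma> = hit_measure (closure E) \<gamma> + lam * energy (\<gamma> - \<gamma>0)" for \<gamma>
  have hit_nonneg: "0 \<le> hit_measure (closure E) \<gamma>" for \<gamma> by (simp add: hit_measure_def)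
  have \<Phi>_nonneg: "0 \<le> \<Phi> \<gamma>" for \<gamma>
    unfolding \<Phi>_def
    by (intro add_nonneg_nonneg mult_nonneg_nonneg hit_nonneg energy_nonneg less_imp_le[OF \<open>0 < lam\<close>])
  define I where "I = Inf (\<Phi> ` B)"
  have bdd: "bdd_below (\<Phi> ` B)" using \<Phi>_nonneg by (auto simp: bdd_below_def)
  have "\<Phi> \<gamma>0 \<le> 1"
  proof -
    have "hit_measure (closure E) \<gamma>0 \<le> measure lebesgue {0..1::real}"
      unfolding hit_measure_def
      by (rule measure_mono_fmeasurable)
         (use lmeasurable_compact[OF compact_hit[OF closed_closure]] fmeasurableD in auto)
    moreover have "energy (0 :: 'h c1) = 0"
      using integral_cong[of "{0..1}" "\<lambda>t. (norm (c1_deriv (0::'h c1) t))\<^sup>2" "\<lambda>_. 0"]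
        norm_c1_deriv_le[of _ "0::'h c1"] by (simp add: energy_def)
    ultimately show ?thesis by (simp add: \<Phi>_def)
  qed
  then have "I \<le> 1" unfolding I_def using cInf_lower[OF imageI[OF \<open>\<gamma>0 \<in> B\<close>] bdd] by simp
  define L where "L = norm \<gamma>0 + \<eta>"
  define \<kappa> where "\<kappa> = c / (L + 2)"
  have "0 < \<kappa>" using por \<open>0 < \<eta>\<close> by (simp add: \<kappa>_def L_def add_nonneg_pos)
  \<comment> \<open>The bound \<open>\<eta>/12\<close> keeps \<open>\<eta>/2 + 3\<epsilon>\<close> below \<open>\<eta>\<close>; the bound \<open>\<kappa>/(16 \<lambda>)\<close> makes the energy
    cost \<open>8 \<lambda> \<epsilon>\<^sup>2 \<sigma>\<close> at most half of the gain \<open>\<kappa> \<epsilon> \<sigma>\<close>.\<close>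
  define \<epsilon> where "\<epsilon> = min 1 (min (\<eta> / 12) (\<kappa> / (16 * lam)))"
  have \<epsilon>: "0 < \<epsilon>" "\<epsilon> \<le> 1" "\<epsilon> \<le> \<eta> / 12" "\<epsilon> \<le> \<kappa> / (16 * lam)"
    using \<open>0 < \<eta>\<close> \<open>0 < \<kappa>\<close> \<open>0 < lam\<close> by (simp_all add: \<epsilon>_def)
  \<comment> \<open>Gain minus energy cost is at least \<open>\<kappa> \<epsilon> \<sigma> / 2 \<ge> 2 \<tau>\<close>, as \<open>\<sigma> > \<delta>/2\<close>. One \<open>\<tau>\<close> absorbs
    the measure error of the perturbation step, the other contradicts near-minimality.\<close>
  define \<tau> where "\<tau> = \<kappa> * \<epsilon> * \<delta> / 8"
  have "0 < \<tau>" using \<open>0 < \<kappa>\<close> \<epsilon>(1) \<open>0 < \<delta>\<close> by (simp add: \<tau>_def)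
  \<comment> \<open>A near-minimiser need not belong to the dense set, but by upper semicontinuity its neighbours are
    near-minimisers too, and one of them does.\<close>
  obtain \<gamma> where "\<gamma> \<in> ?N" "\<gamma> \<in> B" "\<Phi> \<gamma> < I + min \<tau> 1"
  proof -
    have "Inf (\<Phi> ` B) < I + min \<tau> 1" using \<open>0 < \<tau>\<close> by (simp add: I_def)
    then obtain \<beta> where \<beta>: "\<beta> \<in> B" "\<Phi> \<beta> < I + min \<tau> 1"
      using \<open>\<gamma>0 \<in> B\<close> cInf_lessD[of "\<Phi> ` B"] by blast
    obtain \<zeta>1 where \<zeta>1: "0 < \<zeta>1" "\<And>\<gamma>. dist \<gamma> \<beta> < \<zeta>1 \<Longrightarrow> \<Phi> \<gamma> < I + min \<tau> 1"
      using hit_measure_plus_energy_upper_semicontinuous[OF closed_closure less_imp_le[OF \<open>0 < lam\<close>]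
          \<beta>(2)[unfolded \<Phi>_def]] unfolding \<Phi>_def by blast
    obtain \<zeta>2 where \<zeta>2: "0 < \<zeta>2" "\<And>\<gamma>. dist \<gamma> \<beta> < \<zeta>2 \<Longrightarrow> \<gamma> \<in> B" using Bopen[OF \<beta>(1)] by blast
    have "\<beta> \<in> closure ?N" using \<beta>(1) \<open>B \<subseteq> closure ?N\<close> by blast
    moreover have "0 < min \<zeta>1 \<zeta>2" using \<zeta>1(1) \<zeta>2(1) by simp
    ultimately obtain \<gamma> where "\<gamma> \<in> ?N" "dist \<gamma> \<beta> < min \<zeta>1 \<zeta>2"
      unfolding closure_approachable by blast
    then show thesis using that[of \<gamma>] \<zeta>1(2) \<zeta>2(2) by simp
  qed
  define \<omega> where "\<omega> = \<gamma> - \<gamma>0"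
  let ?T = "{t \<in> {0..1}. c1_apply \<gamma> t \<in> E}"
  let ?Bad = "{t \<in> {0..1}. \<eta> / 2 \<le> norm (c1_deriv \<omega> t)}"
  define G where "G = ?T - ?Bad - {0, 1}"
  have bad: "?Bad \<in> lmeasurable" "measure lebesgue ?Bad \<le> \<delta> / 2"
  proof -
    show "?Bad \<in> lmeasurable"
      using large_derivative_measure_le_energy(1)[of "\<eta> / 2" \<omega>] \<open>0 < \<eta>\<close> by simp
    have "lam * energy \<omega> \<le> 2"
      using hit_nonneg[of \<gamma>] \<open>\<Phi> \<gamma> < I + min \<tau> 1\<close> \<open>I \<le> 1\<close> by (simp add: \<Phi>_def \<omega>_def)
    then have "energy \<omega> \<le> (\<eta> / 2)\<^sup>2 * (\<delta> / 2)"
      using \<open>0 < \<delta>\<close> \<open>0 < \<eta>\<close> by (simp add: lam_def power2_eq_square field_simps)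
    moreover have "(\<eta> / 2)\<^sup>2 * measure lebesgue ?Bad \<le> energy \<omega>"
      using \<open>0 < \<eta>\<close> by (intro large_derivative_measure_le_energy(2)) simp
    ultimately have "(\<eta> / 2)\<^sup>2 * measure lebesgue ?Bad \<le> (\<eta> / 2)\<^sup>2 * (\<delta> / 2)" by (rule order_trans[rotated])
    moreover have "0 < (\<eta> / 2)\<^sup>2" using \<open>0 < \<eta>\<close> by simp
    ultimately show "measure lebesgue ?Bad \<le> \<delta> / 2" by (rule mult_left_le_imp_le)
  qed
  have outer: "ennreal (\<delta> / 2) < outer_measure_of lebesgue G"
  proof (rule ccontr)
    assume "\<not> ?thesis"
    then have G: "outer_measure_of lebesgue G \<le> ennreal (\<delta> / 2)" by simp
    have "outer_measure_of lebesgue ?Bad = emeasure lebesgue ?Bad"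
      by (rule outer_measure_of_eq[OF fmeasurableD[OF bad(1)]])
    also have "\<dots> \<le> ennreal (\<delta> / 2)"
      using bad by (simp add: emeasure_eq_measure2 ennreal_leI)
    finally have b: "outer_measure_of lebesgue ?Bad \<le> ennreal (\<delta> / 2)" .
    have z: "outer_measure_of lebesgue {0, 1 :: real} = 0"
      unfolding outer_measure_of_lebesgue_eq_0_iff by (rule negligible_finite) simp
    have "ennreal \<delta> < outer_measure_of lebesgue ?T" using \<open>\<gamma> \<in> ?N\<close> by simp
    also have "\<dots> \<le> outer_measure_of lebesgue (G \<union> (?Bad \<union> {0, 1}))"
      by (intro outer_measure_of_mono) (auto simp: G_def)
    also have "\<dots> \<le> outer_measure_of lebesgue G + outer_measure_of lebesgue (?Bad \<union> {0, 1})"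
      by (rule outer_measure_of_lebesgue_Un)
    also have "\<dots> \<le> outer_measure_of lebesgue G + (outer_measure_of lebesgue ?Bad + outer_measure_of lebesgue {0, 1 :: real})"
      by (intro add_left_mono outer_measure_of_lebesgue_Un)
    also have "\<dots> \<le> ennreal (\<delta> / 2) + (ennreal (\<delta> / 2) + 0)"
      unfolding z by (intro add_mono G b order_refl)
    also have "\<dots> = ennreal \<delta>" using \<open>0 < \<delta>\<close> by (simp flip: ennreal_plus)
    finally show False by simp
  qed
  have L: "norm (c1_deriv \<gamma> t) \<le> L" if t: "t \<in> {0..1}" for t
  proof -
    have "norm (c1_deriv (\<gamma> - \<gamma>0) t) \<le> sup_norm (c1_deriv (\<gamma> - \<gamma>0))"
      by (rule sup_norm_upper[OF continuous_on_c1_deriv t])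
    then have "norm (c1_deriv \<gamma> t - c1_deriv \<gamma>0 t) \<le> \<eta>"
      using \<open>\<gamma> \<in> B\<close> t by (simp add: B_def c1_deriv_diff)
    then show ?thesis
      using norm_triangle_sub[of "c1_deriv \<gamma> t" "c1_deriv \<gamma>0 t"] norm_c1_deriv_le[OF t, of \<gamma>0]
      by (simp add: L_def)
  qed
  define \<xi> where "\<xi> = (\<eta> - sup_norm (c1_apply \<omega>)) / 2"
  have "0 < \<xi>" using \<open>\<gamma> \<in> B\<close> by (simp add: \<xi>_def B_def \<omega>_def)
  have Gprops: "G \<subseteq> {0<..<1}" "\<And>t. t \<in> G \<Longrightarrow> c1_apply \<gamma> t \<in> E"
    "\<And>t. t \<in> G \<Longrightarrow> norm (c1_deriv \<omega> t) \<le> \<eta> / 2"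
    by (auto simp: G_def)
  obtain v \<sigma> where v: "\<And>t. t \<in> {0..1} \<Longrightarrow> norm (c1_apply v t) < \<xi>"
    "\<And>t. t \<in> {0..1} \<Longrightarrow> norm (c1_deriv (\<omega> + v) t) \<le> max (norm (c1_deriv \<omega> t)) (\<eta> / 2 + 3 * \<epsilon>)"
    "\<delta> / 2 < \<sigma>"
    "hit_measure (closure E) (\<gamma> + v) \<le> hit_measure (closure E) \<gamma> + \<tau> - c / (L + 2) * \<epsilon> * \<sigma>"
    "energy (\<omega> + v) \<le> energy \<omega> + 8 * \<epsilon>\<^sup>2 * \<sigma>"
    by (rule porous_improvement[OF por L \<epsilon>(1,2) \<open>0 < \<xi>\<close> \<open>0 < \<tau>\<close> Gprops outer])
       (use \<open>0 < \<delta>\<close> in \<open>auto\<close>)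
  have eq: "\<gamma> + v - \<gamma>0 = \<omega> + v" by (simp add: \<omega>_def)
  have "\<gamma> + v \<in> B"
  proof -
    have "sup_norm (c1_apply (\<omega> + v)) \<le> sup_norm (c1_apply \<omega>) + \<xi>"
    proof (rule sup_norm_least)
      fix t :: real assume t: "t \<in> {0..1}"
      show "norm (c1_apply (\<omega> + v) t) \<le> sup_norm (c1_apply \<omega>) + \<xi>"
        unfolding c1_apply_plus
        by (rule norm_triangle_mono[OF sup_norm_upper[OF continuous_on_c1_apply t] less_imp_le[OF v(1)[OF t]]])
    qed
    moreover have "\<xi> + \<xi> = \<eta> - sup_norm (c1_apply \<omega>)" by (simp add: \<xi>_def)
    ultimately have 1: "sup_norm (c1_apply (\<omega> + v)) < \<eta>"
      using \<open>0 < \<xi>\<close> by linarith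
    have "sup_norm (c1_deriv (\<omega> + v)) \<le> max (sup_norm (c1_deriv \<omega>)) (\<eta> / 2 + 3 * \<epsilon>)"
    proof (rule sup_norm_least)
      fix t :: real assume t: "t \<in> {0..1}"
      show "norm (c1_deriv (\<omega> + v) t) \<le> max (sup_norm (c1_deriv \<omega>)) (\<eta> / 2 + 3 * \<epsilon>)"
        using v(2)[OF t] sup_norm_upper[OF continuous_on_c1_deriv[of \<omega>] t] by linarith
    qed
    also have "\<dots> < \<eta>"
      using \<epsilon>(3) \<open>0 < \<eta>\<close> \<open>\<gamma> \<in> B\<close> by (simp add: B_def \<omega>_def)
    finally show ?thesis using 1 by (simp add: B_def eq)
  qed
  then have "I \<le> \<Phi> (\<gamma> + v)" unfolding I_def by (intro cInf_lower bdd imageI)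
  moreover have "\<Phi> (\<gamma> + v) \<le> \<Phi> \<gamma> - \<tau>"
  proof -
    have "0 < \<sigma>" using v(3) \<open>0 < \<delta>\<close> by linarith
    have "lam * energy (\<omega> + v) \<le> lam * (energy \<omega> + 8 * \<epsilon>\<^sup>2 * \<sigma>)"
      using v(5) \<open>0 < lam\<close> by (intro mult_left_mono) auto
    moreover have "lam * (8 * \<epsilon>\<^sup>2 * \<sigma>) \<le> \<kappa> / 2 * \<epsilon> * \<sigma>"
    proof -
      have "8 * lam * \<epsilon> \<le> \<kappa> / 2"
        using \<epsilon>(4) \<open>0 < lam\<close> by (simp add: field_simps)
      then have "8 * lam * \<epsilon> * (\<epsilon> * \<sigma>) \<le> \<kappa> / 2 * (\<epsilon> * \<sigma>)"
        using \<open>0 < \<sigma>\<close> \<epsilon>(1) by (intro mult_right_mono) auto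
      then show ?thesis by (simp add: power2_eq_square algebra_simps)
    qed
    moreover have "2 * \<tau> \<le> \<kappa> / 2 * \<epsilon> * \<sigma>"
    proof -
      have "\<kappa> / 2 * \<epsilon> * (\<delta> / 2) \<le> \<kappa> / 2 * \<epsilon> * \<sigma>"
        using v(3) \<open>0 < \<kappa>\<close> \<epsilon>(1) by (intro mult_left_mono) auto
      then show ?thesis by (simp add: \<tau>_def)
    qed
    moreover have "\<kappa> * \<epsilon> * \<sigma> = \<kappa> / 2 * \<epsilon> * \<sigma> + \<kappa> / 2 * \<epsilon> * \<sigma>" by simp
    ultimately show ?thesis
      using v(4) unfolding \<Phi>_def eq \<omega>_def[symmetric] \<kappa>_def[symmetric] distrib_left by linarith
  qed
  ultimately show False using \<open>\<Phi> \<gamma> < I + min \<tau> 1\<close> by linarith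
qed

theorem theorem3p9:
  fixes P :: "'h::{real_inner, banach} set"
  assumes "sigma_porous P"
  shows "Gamma1_null P"
proof -
  obtain \<F> where \<F>: "countable \<F>" "\<forall>E\<in>\<F>. porous E" "P = \<Union>\<F>"
    using assms unfolding sigma_porous_def by blast
  define T where "T A \<gamma> = {t \<in> {0..1}. c1_apply \<gamma> t \<in> A}" for A and \<gamma> :: "'h c1"
  define N where "N E n = {\<gamma>. ennreal (inverse (real (Suc n))) < outer_measure_of lebesgue (T E \<gamma>)}" for E n
  have "- {\<gamma>. outer_measure_of lebesgue (T P \<gamma>) = 0} = (\<Union>E\<in>\<F>. \<Union>n. N E n)"
  proof (intro set_eqI iffI)
    fix \<gamma> assume "\<gamma> \<in> - {\<gamma>. outer_measure_of lebesgue (T P \<gamma>) = 0}"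
    then have "\<not> negligible (T P \<gamma>)" by (simp add: outer_measure_of_lebesgue_eq_0_iff)
    moreover have "T P \<gamma> = \<Union>((\<lambda>E. T E \<gamma>) ` \<F>)" by (auto simp: T_def \<F>(3))
    ultimately obtain E where E: "E \<in> \<F>" "\<not> negligible (T E \<gamma>)"
      using negligible_countable_Union[of "(\<lambda>E. T E \<gamma>) ` \<F>"] \<F>(1) by auto
    then have "outer_measure_of lebesgue (T E \<gamma>) \<noteq> 0" by (simp add: outer_measure_of_lebesgue_eq_0_iff)
    then obtain n where "ennreal (inverse (real (Suc n))) < outer_measure_of lebesgue (T E \<gamma>)"
      by (rule ennreal_pos_gt_inverse_Suc)
    then show "\<gamma> \<in> (\<Union>E\<in>\<F>. \<Union>n. N E n)" using E(1) by (auto simp: N_def)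
  next
    fix \<gamma> assume "\<gamma> \<in> (\<Union>E\<in>\<F>. \<Union>n. N E n)"
    then obtain E n where E: "E \<in> \<F>" "ennreal (inverse (real (Suc n))) < outer_measure_of lebesgue (T E \<gamma>)"
      by (auto simp: N_def)
    have "outer_measure_of lebesgue (T E \<gamma>) \<le> outer_measure_of lebesgue (T P \<gamma>)"
      using E(1) by (intro outer_measure_of_mono) (auto simp: T_def \<F>(3))
    then show "\<gamma> \<in> - {\<gamma>. outer_measure_of lebesgue (T P \<gamma>) = 0}" using E(2) by auto
  qed
  also have "\<dots> = \<Union>((\<lambda>(E, n). N E n) ` (\<F> \<times> UNIV))" by auto
  finally have eq: "- {\<gamma>. outer_measure_of lebesgue (T P \<gamma>) = 0} = \<Union>((\<lambda>(E, n). N E n) ` (\<F> \<times> UNIV))" .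
  have "nowhere_dense (N E n)" if "E \<in> \<F>" for E n
  proof -
    obtain c where "0 < c" "c < 1" "c_porous c E" using \<F>(2) \<open>E \<in> \<F>\<close> unfolding porous_def by blast
    then show ?thesis
      unfolding N_def T_def by (intro nowhere_dense_long_time_in_porous[of c]) auto
  qed
  then have "meagre (- {\<gamma>. outer_measure_of lebesgue (T P \<gamma>) = 0})"
    unfolding meagre_def using eq \<F>(1)
    by (intro exI[of _ "(\<lambda>(E, n). N E n) ` (\<F> \<times> UNIV)"]) auto
  then show ?thesis unfolding Gamma1_null_def residual_def T_def .
qed

end
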